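(* Let $f:2^{[n]}\to\mathbb{R}_{\geq 0}$ with $f(\emptyset)=0$, and let $d$ be an integer with $2\leq d\leq \deg(f)$. If $f$ is 2-coverage with respect to $d$, then $f^{(d)}$ is completely log-concave, i.e. the generating polynomial $p_{f^{(d)}}(z)=\sum_{S\subseteq[n],\,|S|=d} f(S)\prod_{i\in S}z_i$ is completely log-concave.
   Context: For $f:2^{[n]}\to\mathbb{R}_{\geq0}$, its generating polynomial is $p_f(z_1,\dots,z_n)=\sum_{S\subseteq[n]}f(S)\prod_{i\in S}z_i$, and $\deg(f)$ is the degree of $p_f$. For $0\le d\le n$, $f^{(d)}(S)=f(S)$ if $|S|=d$ and $0$ otherwise. For $\tau\subseteq[n]$, $f_\tau$ is the set function on $[n]\setminus\tau$ whose generating polynomial is $(\prod_{i\in\tau}\partial_{z_i})p_f$, i.e. $f_\tau(T)=f(T\cup\tau)$ for $T\subseteq[n]\setminus\tau$. A polynomial is decomposable if it is a sum of two nonzero polynomials supported on disjoint sets of variables, and indecomposable otherwise; a set function is indecomposable if its generating polynomial is. A polynomial $p\in\mathbb{R}[z_1,\dots,z_n]$ is log-concave if it is nonnegative on $\mathbb{R}^n_{\ge0}$ and $\log p$ is concave on $\mathbb{R}^n_{\ge0}$ (the zero polynomial counts as log-concave); it is completely log-concave if for every $k\ge0$ and all $a_1,\dots,a_k\in\mathbb{R}^n_{\ge0}$, $D_{a_1}\cdots D_{a_k}p$ is nonnegative and log-concave on $\mathbb{R}^n_{\ge0}$, where $D_a=\sum_i a_i\partial_{z_i}$. A function $g:2^{S}\to\mathbb{R}_{\ge0}$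 is a coverage function if there are a finite set $U$, subsets $A_i\subseteq U$ ($i\in S$) and a nonnegative measure $w$ on $U$ with $g(T)=w(\bigcup_{i\in T}A_i)$ for all $T\subseteq S$. A function $\ell:2^S\to\mathbb{R}_{\ge0}$ is linear if $\ell(T)=\sum_{i\in T}\ell(\{i\})$. The function $f$ is 2-coverage with respect to $d$ ($2\le d\le\deg f$) if: (i) for every $\tau\subseteq[n]$ with $|\tau|\le d-2$, $(f^{(d)})_\tau$ is indecomposable; and (ii) for every $\tau\subseteq[n]$ with $|\tau|=d-2$ there exist $S\subseteq[n]\setminus\tau$, a coverage function $g:2^S\to\mathbb{R}_{\ge0}$ and a linear set function $\ell:2^S\to\mathbb{R}_{\ge0}$ such that $\ell(\{i\})\le g(\{i\})$ for all $i\in S$, and for every $T\subseteq[n]\setminus\tau$ with $|T|=2$, $f_\tau(T)=0$ if $T\not\subseteq S$ and $f_\tau(T)=g(T)-\tfrac12\ell(T)$ otherwise. *)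

theory Defs
  imports "HOL-Analysis.Analysis" "HOL-Library.Poly_Mapping"
begin

text \<open>
  The ground set \<open>[n]\<close> is the universe of an arbitrary finite type \<open>'n\<close>, so that set functions
  have type \<open>'n set \<Rightarrow> real\<close> and points have type \<open>real ^ 'n\<close>. A polynomial in the variables
  \<open>z\<^sub>i\<close> maps exponent vectors to coefficients; ring operations are those of Poly_Mapping.
\<close>

type_synonym 'n rpoly = "('n \<Rightarrow>\<^sub>0 nat) \<Rightarrow>\<^sub>0 real"

definition Cst :: "real \<Rightarrow> 'n rpoly" where
  "Cst c = Poly_Mapping.single 0 c"

definition Var :: "'n \<Rightarrow> 'n rpoly" where
  "Var i = Poly_Mapping.single (Poly_Mapping.single i 1) 1"

definition eval_poly :: "('n::finite) rpoly \<Rightarrow> real ^ 'n \<Rightarrow> real" where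
  "eval_poly p x =
     (\<Sum>m\<in>Poly_Mapping.keys p. Poly_Mapping.lookup p m * (\<Prod>i\<in>UNIV. (x $ i) ^ Poly_Mapping.lookup m i))"

definition poly_vars :: "'n rpoly \<Rightarrow> 'n set" where
  "poly_vars p = (\<Union>m\<in>Poly_Mapping.keys p. Poly_Mapping.keys m)"

definition total_degree :: "('n::finite) rpoly \<Rightarrow> nat" where
  "total_degree p =
     Max (insert 0 ((\<lambda>m. \<Sum>i\<in>UNIV. Poly_Mapping.lookup m i) ` Poly_Mapping.keys p))"

text \<open>
  Termwise formal partial derivative. The truncated subtraction of exponents is harmless: a
  monomial that does not contain \<open>z\<^sub>i\<close> gets coefficient 0.
\<close>

definition partial_deriv :: "'n \<Rightarrow> 'n rpoly \<Rightarrow> 'n rpoly" where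
  "partial_deriv i p =
     (\<Sum>m\<in>Poly_Mapping.keys p.
        Poly_Mapping.single (m - Poly_Mapping.single i 1)
          (of_nat (Poly_Mapping.lookup m i) * Poly_Mapping.lookup p m))"

definition dir_deriv :: "real ^ 'n \<Rightarrow> ('n::finite) rpoly \<Rightarrow> 'n rpoly" where
  "dir_deriv a p = (\<Sum>i\<in>UNIV. Cst (a $ i) * partial_deriv i p)"

definition nonneg_orthant :: "(real ^ 'n::finite) set" where
  "nonneg_orthant = {x. \<forall>i. 0 \<le> x $ i}"

text \<open>
  Here \<open>log 0\<close> is \<open>-\<infinity>\<close>. Concavity on the orthant of a function with values in
  \<open>[-\<infinity>, \<infinity>)\<close> means that the set where it is finite is convex and that it is concave there;
  \<^const>\<open>concave_on\<close> includes convexity of the domain. The zero polynomial is log-concave.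
\<close>

definition log_concave_poly :: "('n::finite) rpoly \<Rightarrow> bool" where
  "log_concave_poly p \<longleftrightarrow>
     (\<forall>x\<in>nonneg_orthant. 0 \<le> eval_poly p x) \<and>
     concave_on {x \<in> nonneg_orthant. 0 < eval_poly p x} (\<lambda>x. ln (eval_poly p x))"

definition completely_log_concave_poly :: "('n::finite) rpoly \<Rightarrow> bool" where
  "completely_log_concave_poly p \<longleftrightarrow>
     (\<forall>as. set as \<subseteq> nonneg_orthant \<longrightarrow> log_concave_poly (foldr dir_deriv as p))"

text \<open>
  The last conjunct says that the constant term of \<open>p\<close> is not split between \<open>q\<close> and \<open>r\<close>. It is
  needed since nonzero constants are supported on the empty set of variables: without it
  \<open>p = (p - c) + c\<close> with \<open>c \<noteq> 0\<close> would make every polynomial decomposable, even \<open>0 = (-1) + 1\<close>.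
\<close>

definition decomposable_poly :: "'n rpoly \<Rightarrow> bool" where
  "decomposable_poly p \<longleftrightarrow>
     (\<exists>q r. p = q + r \<and> q \<noteq> 0 \<and> r \<noteq> 0 \<and> poly_vars q \<inter> poly_vars r = {} \<and>
            (Poly_Mapping.lookup q 0 = 0 \<or> Poly_Mapping.lookup r 0 = 0))"

definition gen_poly :: "('n::finite set \<Rightarrow> real) \<Rightarrow> 'n rpoly" where
  "gen_poly f = (\<Sum>S\<in>UNIV. Cst (f S) * (\<Prod>i\<in>S. Var i))"

definition set_fun_degree :: "('n::finite set \<Rightarrow> real) \<Rightarrow> nat" where
  "set_fun_degree f = total_degree (gen_poly f)"

definition indecomposable_set_fun :: "('n::finite set \<Rightarrow> real) \<Rightarrow> bool" where
  "indecomposable_set_fun f \<longleftrightarrow> \<not> decomposable_poly (gen_poly f)"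

definition layer :: "('n set \<Rightarrow> real) \<Rightarrow> nat \<Rightarrow> 'n set \<Rightarrow> real" where
  "layer f d S = (if card S = d then f S else 0)"

text \<open>
  The function \<open>f\<^sub>\<tau>\<close> lives on the subsets of the complement of \<open>\<tau>\<close>; it is extended by 0 to all
  sets, which does not change its generating polynomial (see \<open>gen_poly_link_insert\<close> below).
\<close>

definition link :: "('n set \<Rightarrow> real) \<Rightarrow> 'n set \<Rightarrow> 'n set \<Rightarrow> real" where
  "link f \<tau> T = (if T \<inter> \<tau> = {} then f (T \<union> \<tau>) else 0)"

text \<open>A nonnegative measure on the finite set \<open>U\<close> is given by its point masses \<open>w u\<close>.\<close>

definition coverage_on :: "'n set \<Rightarrow> ('n set \<Rightarrow> real) \<Rightarrow> bool" where
  "coverage_on S g \<longleftrightarrow>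
     (\<exists>(U :: nat set) A w. finite U \<and> (\<forall>i\<in>S. A i \<subseteq> U) \<and> (\<forall>u\<in>U. 0 \<le> w u) \<and>
        (\<forall>T\<subseteq>S. g T = (\<Sum>u\<in>(\<Union>i\<in>T. A i). w u)))"

definition linear_set_fun_on :: "'n set \<Rightarrow> ('n set \<Rightarrow> real) \<Rightarrow> bool" where
  "linear_set_fun_on S l \<longleftrightarrow> (\<forall>T\<subseteq>S. 0 \<le> l T \<and> l T = (\<Sum>i\<in>T. l {i}))"

definition two_coverage :: "('n::finite set \<Rightarrow> real) \<Rightarrow> nat \<Rightarrow> bool" where
  "two_coverage f d \<longleftrightarrow>
     (\<forall>\<tau>. card \<tau> \<le> d - 2 \<longrightarrow> indecomposable_set_fun (link (layer f d) \<tau>)) \<and>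
     (\<forall>\<tau>. card \<tau> = d - 2 \<longrightarrow>
        (\<exists>S g l. S \<subseteq> - \<tau> \<and> coverage_on S g \<and> linear_set_fun_on S l \<and>
           (\<forall>i\<in>S. l {i} \<le> g {i}) \<and>
           (\<forall>T. T \<subseteq> - \<tau> \<and> card T = 2 \<longrightarrow>
              link f \<tau> T = (if T \<subseteq> S then g T - l T / 2 else 0))))"

definition set_monom :: "'n::finite set \<Rightarrow> 'n \<Rightarrow>\<^sub>0 nat" where
  "set_monom S = (\<Sum>i\<in>S. Poly_Mapping.single i 1)"

lemma lookup_set_monom: "Poly_Mapping.lookup (set_monom S) i = (if i \<in> S then 1 else 0)"
  by (simp add: set_monom_def lookup_sum lookup_single when_def)

lemma keys_set_monom [simp]: "Poly_Mapping.keys (set_monom S) = S"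
  by (auto simp: in_keys_iff lookup_set_monom split: if_splits)

lemma set_monom_inject [simp]: "set_monom S = set_monom T \<longleftrightarrow> S = T"
  by (metis keys_set_monom)

lemma prod_Var: "(\<Prod>i\<in>S. Var i) = Poly_Mapping.single (set_monom S) 1" for S :: "'n::finite set"
proof (induction S rule: infinite_finite_induct)
  case (insert i S)
  then show ?case by (simp add: Var_def mult_single set_monom_def)
qed (auto simp: set_monom_def)

lemma gen_poly_single: "gen_poly f = (\<Sum>S\<in>UNIV. Poly_Mapping.single (set_monom S) (f S))"
  by (simp add: gen_poly_def prod_Var Cst_def mult_single)

lemma lookup_gen_poly_set_monom: "Poly_Mapping.lookup (gen_poly f) (set_monom S) = f S"
  by (simp add: gen_poly_single lookup_sum lookup_single when_def)

lemma lookup_gen_poly: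
  "Poly_Mapping.lookup (gen_poly f) m = (if m \<in> range set_monom then f (Poly_Mapping.keys m) else 0)"
proof (cases "m \<in> range set_monom")
  case True
  then show ?thesis by (auto simp: lookup_gen_poly_set_monom)
next
  case False
  then show ?thesis by (auto simp: gen_poly_single lookup_sum lookup_single when_def intro!: sum.neutral)
qed

lemma keys_gen_poly: "Poly_Mapping.keys (gen_poly f) = set_monom ` {S. f S \<noteq> 0}"
  by (auto simp: in_keys_iff lookup_gen_poly split: if_splits)

lemma set_fun_degree_eq: "set_fun_degree f = Max (insert 0 (card ` {S. f S \<noteq> 0}))"
  by (simp add: set_fun_degree_def total_degree_def keys_gen_poly image_image lookup_set_monom sum.If_cases)

lemma eval_gen_poly: "eval_poly (gen_poly f) x = (\<Sum>S\<in>UNIV. f S * (\<Prod>i\<in>S. x $ i))"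
proof -
  have *: "(\<Prod>i\<in>UNIV. (x $ i) ^ Poly_Mapping.lookup (set_monom S) i) = (\<Prod>i\<in>S. x $ i)" for S
    by (simp add: lookup_set_monom if_distrib prod.If_cases cong: if_cong)
  have "eval_poly (gen_poly f) x = (\<Sum>S\<in>{S. f S \<noteq> 0}. f S * (\<Prod>i\<in>S. x $ i))"
    by (simp add: eval_poly_def keys_gen_poly sum.reindex inj_on_def lookup_gen_poly_set_monom *)
  also have "\<dots> = (\<Sum>S\<in>UNIV. f S * (\<Prod>i\<in>S. x $ i))"
    by (rule sum.mono_neutral_left) auto
  finally show ?thesis .
qed

lemma lookup_partial_deriv:
  "Poly_Mapping.lookup (partial_deriv i p) m =
     of_nat (Poly_Mapping.lookup m i + 1) * Poly_Mapping.lookup p (m + Poly_Mapping.single i 1)"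
proof -
  let ?e = "Poly_Mapping.single i (1::nat)"
  have eq: "(of_nat (Poly_Mapping.lookup k i) * Poly_Mapping.lookup p k when k - ?e = m) =
        (if k = m + ?e then of_nat (Poly_Mapping.lookup m i + 1) * Poly_Mapping.lookup p (m + ?e) else 0)" for k
  proof (cases "Poly_Mapping.lookup k i = 0")
    case True
    then have "k \<noteq> m + ?e" by (auto simp: lookup_add)
    with True show ?thesis by (simp add: when_def)
  next
    case False
    then have "k - ?e + ?e = k"
      by (intro poly_mapping_eqI) (auto simp: lookup_add lookup_minus lookup_single when_def)
    then have "k - ?e = m \<longleftrightarrow> k = m + ?e" by auto
    then show ?thesis by (auto simp: when_def lookup_add)
  qed
  show ?thesis
    unfolding partial_deriv_def lookup_sum lookup_single eq
    by (auto simp: in_keys_iff)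
qed

lemma gen_poly_link_singleton: "gen_poly (link f {i}) = partial_deriv i (gen_poly f)"
proof (rule poly_mapping_eqI)
  fix m
  let ?e = "Poly_Mapping.single i (1::nat)"
  have ins: "set_monom S + ?e = set_monom (insert i S)" if "i \<notin> S" for S
    using that by (simp add: set_monom_def add.commute)
  show "Poly_Mapping.lookup (gen_poly (link f {i})) m = Poly_Mapping.lookup (partial_deriv i (gen_poly f)) m"
  proof (cases "\<exists>S. i \<notin> S \<and> m = set_monom S")
    case True
    then obtain S where S: "i \<notin> S" "m = set_monom S" by auto
    then show ?thesis
      by (simp add: lookup_partial_deriv lookup_gen_poly_set_monom link_def ins[OF S(1)]
          lookup_set_monom del: One_nat_def)
  next
    case False
    have "m + ?e \<notin> range set_monom"
    proof
      assume "m + ?e \<in> range set_monom"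
      then obtain T where T: "m + ?e = set_monom T" by auto
      have "Poly_Mapping.lookup m i + 1 = (if i \<in> T then 1 else 0)"
        using arg_cong[OF T, of "\<lambda>k. Poly_Mapping.lookup k i"] by (simp add: lookup_add lookup_set_monom)
      then have "i \<in> T" by (simp split: if_splits)
      then have "m + ?e = set_monom (T - {i}) + ?e" using T ins[of "T - {i}"] by (simp add: insert_absorb)
      then have "m = set_monom (T - {i})" by simp
      with False show False by auto
    qed
    moreover have "Poly_Mapping.lookup (gen_poly (link f {i})) m = 0"
      using False by (auto simp: lookup_gen_poly link_def)
    ultimately show ?thesis by (simp add: lookup_partial_deriv lookup_gen_poly del: One_nat_def)
  qed
qed

lemma link_empty: "link f {} = f"
  by (auto simp: link_def)

lemma gen_poly_link_insert:
  assumes "i \<notin> \<tau>"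
  shows "gen_poly (link f (insert i \<tau>)) = partial_deriv i (gen_poly (link f \<tau>))"
proof -
  have "link f (insert i \<tau>) = link (link f \<tau>) {i}"
    using assms by (auto simp: link_def fun_eq_iff)
  then show ?thesis by (simp add: gen_poly_link_singleton)
qed

end

theory Submission
  imports Defs
begin

text \<open>
  Write \<open>h\<close> for the layer \<open>f\<^bsup>(d)\<^esup>\<close>. All statements reduce to the symmetric multilinear form
  \<open>(a\<^sub>1, \<dots>, a\<^sub>d) \<mapsto> D\<^bsub>a\<^sub>1\<^esub> \<cdots> D\<^bsub>a\<^sub>d\<^esub> p\<^sub>h\<close>. For nonnegative \<open>a\<^sub>1, \<dots>, a\<^bsub>d-2\<^esub>\<close> the bilinear
  form \<open>B(v, w)\<close> that remains satisfies the Alexandrov-Fenchel inequality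
  \<open>B(v, v) B(y, y) \<le> B(v, y)\<^sup>2\<close> for \<open>y \<ge> 0\<close>; Euler's formula turns it into nonpositivity of the
  second derivative of \<open>log\<close> along segments.

  The inequality is proved by induction on \<open>d\<close>. For \<open>d = 2\<close>, the inclusion-exclusion formula
  \<open>g({i,j}) = g({i}) + g({j}) - w(A\<^sub>i \<inter> A\<^sub>j)\<close> shows that \<open>B\<close> is negative semidefinite on the
  hyperplane \<open>\<Sum>\<^bsub>i\<in>S\<^esub> v\<^sub>i = 0\<close>. For the step let \<open>x = a\<^bsub>d-2\<^esub> > 0\<close> and let \<open>B\<^sub>i\<close> be the form of the link
  of \<open>i\<close>, so that \<open>B = \<Sum>\<^sub>i x\<^sub>i B\<^sub>i\<close> and \<open>B\<^sub>i(v, x) = B(e\<^sub>i, v)\<close>. The inequality for \<open>B\<^sub>i\<close> gives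
  \<open>B(v, v) \<le> \<Sum>\<^sub>i x\<^sub>i B(e\<^sub>i, v)\<^sup>2 / B(e\<^sub>i, x)\<close>, which says that every eigenvalue \<open>\<mu>\<close> of \<open>B\<close>
  relative to the diagonal matrix with entries \<open>B(e\<^sub>i, x) / x\<^sub>i\<close> satisfies \<open>\<mu> \<le> \<mu>\<^sup>2\<close>. Its largest
  eigenvalue is \<open>1\<close>, with Perron eigenvector \<open>x\<close>, and is simple by indecomposability, so all
  others are at most \<open>0\<close>.
\<close>

section \<open>Directional derivatives of set functions\<close>

text \<open>Coefficients of the directional derivative: generating polynomials are multiaffine, so
  only variables outside \<open>S\<close> contribute to the monomial of \<open>S\<close> (see
  \<open>dir_deriv_gen_poly\<close>). The value at \<open>{}\<close> is the constant term.\<close>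

definition dderiv :: "real ^ 'n \<Rightarrow> ('n::finite set \<Rightarrow> real) \<Rightarrow> 'n set \<Rightarrow> real" where
  "dderiv a g S = (\<Sum>i\<in>- S. a $ i * g (insert i S))"

text \<open>The zero function is homogeneous of every degree, so vanishing links and derivatives
  need no separate treatment.\<close>

definition homogeneous_set_fun :: "nat \<Rightarrow> ('n set \<Rightarrow> real) \<Rightarrow> bool" where
  "homogeneous_set_fun m g \<longleftrightarrow> (\<forall>S. g S \<noteq> 0 \<longrightarrow> card S = m)"

lemma dderiv_axis: "dderiv (axis i 1) g = link g {i}"
proof
  fix S
  have "dderiv (axis i 1) g S = (\<Sum>j\<in>- S. if j = i then g (insert i S) else 0)"
    unfolding dderiv_def by (intro sum.cong) (auto simp: axis_def)
  also have "\<dots> = link g {i} S" by (auto simp: link_def)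
  finally show "dderiv (axis i 1) g S = link g {i} S" .
qed

lemma dderiv_expand: "dderiv v g S = (\<Sum>i\<in>UNIV. v $ i * link g {i} S)"
proof -
  have "(\<Sum>i\<in>UNIV. v $ i * link g {i} S) = (\<Sum>i\<in>- S. v $ i * link g {i} S)"
    by (rule sum.mono_neutral_right) (auto simp: link_def)
  also have "\<dots> = dderiv v g S"
    unfolding dderiv_def by (intro sum.cong) (auto simp: link_def)
  finally show ?thesis by simp
qed

lemma dderiv_commute: "dderiv a (dderiv b g) = dderiv b (dderiv a g)"
proof
  fix S
  \<comment> \<open>Padding both sums with zeros makes the side condition symmetric in
    \<open>i\<close> and \<open>j\<close>, so the sums can be swapped.\<close>
  have *: "dderiv a (dderiv b g) S =
    (\<Sum>i\<in>UNIV. \<Sum>j\<in>UNIV. if i \<in> S \<or> j \<in> S \<or> i = j then 0 else a $ i * b $ j * g (insert i (insert j S)))"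
    for a b :: "real ^ 'a"
  proof -
    have "dderiv a (dderiv b g) S =
      (\<Sum>i\<in>- S. \<Sum>j\<in>- insert i S. a $ i * b $ j * g (insert i (insert j S)))"
      by (simp add: dderiv_def sum_distrib_left insert_commute mult.assoc)
    also have "\<dots> = (\<Sum>i\<in>- S. \<Sum>j\<in>UNIV. if i \<in> S \<or> j \<in> S \<or> i = j then 0 else a $ i * b $ j * g (insert i (insert j S)))"
      by (intro sum.cong[OF refl] sum.mono_neutral_cong_left) auto
    also have "\<dots> = (\<Sum>i\<in>UNIV. \<Sum>j\<in>UNIV. if i \<in> S \<or> j \<in> S \<or> i = j then 0 else a $ i * b $ j * g (insert i (insert j S)))"
      by (intro sum.mono_neutral_left) auto
    finally show ?thesis .
  qed
  show "dderiv a (dderiv b g) S = dderiv b (dderiv a g) S"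
    unfolding * by (subst sum.swap) (intro sum.cong refl, auto simp: insert_commute mult.commute)
qed

lemma foldr_dderiv_commute: "foldr dderiv as (dderiv b g) = dderiv b (foldr dderiv as g)"
  by (induction as) (auto simp: dderiv_commute)

lemma foldr_dderiv_sum:
  "foldr dderiv as (\<lambda>S. \<Sum>i\<in>I. c i * h i S) S = (\<Sum>i\<in>I. c i * foldr dderiv as (h i) S)"
proof (induction as arbitrary: S)
  case (Cons a as)
  show ?case
    unfolding foldr.simps o_apply dderiv_def[of a] Cons.IH
    by (simp add: sum_distrib_left mult.left_commute sum.swap[of _ I])
qed auto

lemma foldr_dderiv_expand:
  "foldr dderiv as (dderiv v g) S = (\<Sum>i\<in>UNIV. v $ i * foldr dderiv as (dderiv (axis i 1) g) S)"
proof -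
  have "dderiv v g = (\<lambda>S. \<Sum>i\<in>UNIV. v $ i * link g {i} S)"
    by (intro ext) (rule dderiv_expand)
  then show ?thesis by (simp add: foldr_dderiv_sum dderiv_axis)
qed

lemma dderiv_zero [simp]: "dderiv a (\<lambda>_. 0) = (\<lambda>_. 0)"
  by (simp add: dderiv_def fun_eq_iff)

lemma foldr_dderiv_zero [simp]: "foldr dderiv as (\<lambda>_. 0) = (\<lambda>_. 0)"
  by (induction as) auto

lemma linear_foldr_dderiv: "linear (\<lambda>v. foldr dderiv as (dderiv v g) S)"
  by (subst foldr_dderiv_expand)
     (intro linear_compose_sum ballI linearI, auto simp: algebra_simps)

lemma bilinear_foldr_dderiv: "bilinear (\<lambda>v w. foldr dderiv as (dderiv v (dderiv w g)) S)"
  unfolding bilinear_def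
proof (intro conjI allI)
  show "linear (\<lambda>w. foldr dderiv as (dderiv v (dderiv w g)) S)" for v
    by (subst dderiv_commute) (rule linear_foldr_dderiv)
qed (rule linear_foldr_dderiv)

lemma foldr_dderiv_nonneg:
  assumes "\<And>S. 0 \<le> g S" "\<And>a i. a \<in> set as \<Longrightarrow> 0 \<le> a $ i"
  shows "0 \<le> foldr dderiv as g S"
  using assms(2)
  by (induction as arbitrary: S) (auto simp: assms(1) dderiv_def intro!: sum_nonneg mult_nonneg_nonneg)

text \<open>Each derivative adds one element to the argument. Choosing these from
  \<open>T - S\<close> gives a path from \<open>S\<close> to \<open>T\<close> with positive
  contribution; all other paths contribute nonnegatively.\<close>

lemma foldr_dderiv_pos:
  assumes "\<And>S. 0 \<le> g S" "\<And>a i. a \<in> set as \<Longrightarrow> 0 < a $ i"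
    and "S \<subseteq> T" "card (T - S) = length as" "0 < g T"
  shows "0 < foldr dderiv as g S"
  using assms(2-4)
proof (induction as arbitrary: S)
  case Nil
  then have "S = T" by auto
  with assms(5) show ?case by simp
next
  case (Cons a as)
  then obtain i where i: "i \<in> T - S" by (metis card.empty length_Cons nat.distinct(1) ex_in_conv)
  have "T - insert i S = (T - S) - {i}" by auto
  then have "0 < foldr dderiv as g (insert i S)"
    using Cons.prems i by (intro Cons.IH) auto
  then have "0 < a $ i * foldr dderiv as g (insert i S)"
    using Cons.prems by auto
  then show ?case
    unfolding foldr.simps o_apply dderiv_def[of a]
    using i Cons.prems(1)
    by (intro sum_pos2[where i = i]) (auto intro!: mult_nonneg_nonneg foldr_dderiv_nonneg assms(1) simp: less_imp_le)
qed

lemma homogeneous_dderiv: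
  assumes "homogeneous_set_fun (Suc m) g"
  shows "homogeneous_set_fun m (dderiv a g)"
  unfolding homogeneous_set_fun_def
proof (intro allI impI)
  fix S assume "dderiv a g S \<noteq> 0"
  then obtain i where "i \<notin> S" "g (insert i S) \<noteq> 0"
    unfolding dderiv_def by (metis (mono_tags, lifting) ComplD mult_eq_0_iff sum.neutral)
  with assms show "card S = m" by (auto simp: homogeneous_set_fun_def)
qed

lemma homogeneous_link_singleton:
  fixes g :: "'n::finite set \<Rightarrow> real"
  shows "homogeneous_set_fun (Suc m) g \<Longrightarrow> homogeneous_set_fun m (link g {i})"
  using homogeneous_dderiv[of m g "axis i 1"] by (simp add: dderiv_axis)

lemma dderiv_homogeneous_0:
  assumes "homogeneous_set_fun 0 g"
  shows "dderiv a g = (\<lambda>_. 0)"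
  using assms by (auto simp: homogeneous_set_fun_def dderiv_def fun_eq_iff intro!: sum.neutral)

lemma tendsto_foldr_dderiv:
  "((\<lambda>e. foldr dderiv (map (\<lambda>a. a + e *\<^sub>R b) as) g S) \<longlongrightarrow> foldr dderiv as g S) (at_right (0::real))"
proof (induction as arbitrary: S)
  case (Cons a as)
  show ?case
    unfolding list.map foldr.simps o_apply dderiv_def[of a] dderiv_def[of "a + _ *\<^sub>R b"]
    by (intro tendsto_sum tendsto_mult Cons.IH) (auto intro!: tendsto_eq_intros)
qed auto

section \<open>Transfer from polynomials to set functions\<close>

lemma lookup_Cst_mult: "Poly_Mapping.lookup (Cst c * p) m = c * Poly_Mapping.lookup p m"
  by (simp add: Cst_def mult_map_scale_conv_mult[symmetric] Poly_Mapping.map.rep_eq when_def)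

lemma dir_deriv_gen_poly: "dir_deriv a (gen_poly g) = gen_poly (dderiv a g)"
  by (rule poly_mapping_eqI)
     (simp add: dir_deriv_def gen_poly_link_singleton[symmetric] lookup_sum lookup_Cst_mult
       lookup_gen_poly dderiv_expand)

section \<open>Bilinear forms with one positive eigenvalue\<close>

text \<open>A form that is nonpositive on the kernel of a linear functional has at most one positive
  direction. If \<open>y\<close> is such a direction, the form is nonpositive on the
  \<open>B\<close>-orthogonal complement of \<open>y\<close>, which is the reversed Cauchy-Schwarz
  inequality.\<close>

lemma bilinear_hyperbolic:
  fixes B :: "'a::real_vector \<Rightarrow> 'a \<Rightarrow> real"
  assumes B: "bilinear B" and sym: "\<And>v w. B v w = B w v"
    and \<phi>: "linear \<phi>" and neg: "\<And>v. \<phi> v = (0::real) \<Longrightarrow> B v v \<le> 0"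
    and y: "0 \<le> B y y"
  shows "B v v * B y y \<le> (B v y)\<^sup>2"
proof (cases "B y y = 0")
  case False
  with y have pos: "0 < B y y" by simp
  \<comment> \<open>The component of \<open>v\<close> that is \<open>B\<close>-orthogonal to
    \<open>y\<close>, scaled by \<open>B y y\<close> to avoid a division.\<close>
  define w where "w = B y y *\<^sub>R v - B v y *\<^sub>R y"
  note bil = bilinear_ladd[OF B] bilinear_radd[OF B] bilinear_lsub[OF B] bilinear_rsub[OF B]
    bilinear_lmul[OF B] bilinear_rmul[OF B]
  have wy: "B w y = 0" "B y w = 0" by (simp_all add: w_def bil sym[of y v])
  have ww: "B w w = B y y * (B v v * B y y - (B v y)\<^sup>2)"
    by (simp add: w_def bil sym[of y v] power2_eq_square algebra_simps)
  have "B w w \<le> 0"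
  proof (rule ccontr)
    assume "\<not> B w w \<le> 0"
    \<comment> \<open>\<open>B\<close> would be positive definite on the plane of \<open>y\<close> and \<open>w\<close>, which meets the kernel of \<open>\<phi>\<close>.\<close>
    define u where "u = \<phi> w *\<^sub>R y - \<phi> y *\<^sub>R w"
    have "\<phi> u = 0" by (simp add: u_def linear_diff[OF \<phi>] linear_scale[OF \<phi>])
    then have "B u u \<le> 0" by (rule neg)
    moreover have "B u u = (\<phi> w)\<^sup>2 * B y y + (\<phi> y)\<^sup>2 * B w w"
      by (simp add: u_def bil wy power2_eq_square algebra_simps)
    moreover have "\<phi> y \<noteq> 0" using neg[of y] pos by auto
    then have "0 < (\<phi> y)\<^sup>2 * B w w" using \<open>\<not> B w w \<le> 0\<close> by simp
    moreover have "0 \<le> (\<phi> w)\<^sup>2 * B y y" using pos by simp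
    ultimately show False by linarith
  qed
  then show ?thesis using ww pos by (simp add: mult_le_0_iff)
qed simp

section \<open>Coordinates and constrained eigenvectors\<close>

lemma bilinear_axis_expand:
  fixes B :: "real ^ 'n \<Rightarrow> 'v::real_vector \<Rightarrow> real"
  assumes "bilinear B"
  shows "B v w = (\<Sum>i\<in>UNIV. v $ i * B (axis i 1) w)"
proof -
  have lin: "linear (\<lambda>v. B v w)" using assms by (simp add: bilinear_def)
  have "B (\<Sum>i\<in>UNIV. v $ i *\<^sub>R axis i 1) w = (\<Sum>i\<in>UNIV. v $ i * B (axis i 1) w)"
    by (simp add: linear_sum[OF lin] bilinear_lmul[OF assms])
  then show ?thesis by (simp add: basis_expansion scalar_mult_eq_scaleR[symmetric])
qed

lemma vec_nonzeroD: "v \<noteq> 0 \<Longrightarrow> \<exists>i. v $ i \<noteq> 0"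
  by (simp add: vec_eq_iff)

text \<open>Maximizing the Rayleigh quotient of \<open>B\<close> relative to the diagonal weights
  \<open>d\<close> over the kernel of \<open>r\<close>: the maximum exists by compactness, and the
  first-order condition is the eigenvector equation, tested only against vectors of that
  kernel.\<close>

lemma bilinear_max_constrained:
  fixes B :: "real ^ 'n \<Rightarrow> real ^ 'n \<Rightarrow> real"
  assumes B: "bilinear B" and sym: "\<And>v w. B v w = B w v"
    and d: "\<And>i. 0 < d i" and v0: "(\<Sum>i\<in>UNIV. r i * v0 $ i) = 0" and pos: "0 < B v0 v0"
  shows "\<exists>v \<mu>. 0 < \<mu> \<and> v \<noteq> 0 \<and> (\<Sum>i\<in>UNIV. r i * v $ i) = 0 \<and>
    B v v = \<mu> * (\<Sum>i\<in>UNIV. d i * (v $ i)\<^sup>2) \<and>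
    (\<forall>u. (\<Sum>i\<in>UNIV. r i * u $ i) = 0 \<longrightarrow> B u v = \<mu> * (\<Sum>i\<in>UNIV. d i * u $ i * v $ i))"
proof -
  define N where "N v = (\<Sum>i\<in>UNIV. d i * (v $ i)\<^sup>2)" for v :: "real ^ 'n"
  define L where "L v = (\<Sum>i\<in>UNIV. r i * v $ i)" for v :: "real ^ 'n"
  note bil = bilinear_ladd[OF B] bilinear_radd[OF B] bilinear_lmul[OF B] bilinear_rmul[OF B]
  have N_scale: "N (c *\<^sub>R v) = c\<^sup>2 * N v" for c v
    by (simp add: N_def sum_distrib_left power_mult_distrib algebra_simps)
  have L_scale: "L (c *\<^sub>R v) = c * L v" for c v
    by (simp add: L_def sum_distrib_left algebra_simps)
  have N_pos: "0 < N v" if nz: "v \<noteq> 0" for v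
  proof -
    obtain i where "v $ i \<noteq> 0" using vec_nonzeroD[OF nz] by blast
    then show ?thesis unfolding N_def using d
      by (intro sum_pos2[where i = i]) (auto simp: less_imp_le)
  qed
  have contB: "continuous_on A (\<lambda>v. B v v)" for A
    using bilinear_continuous_on_compose[OF continuous_on_id continuous_on_id B, of A] by simp
  define K where "K = {v. N v = 1} \<inter> {v. L v = 0}"
  have contN: "continuous_on A N" and contL: "continuous_on A L" for A
    unfolding N_def L_def by (intro continuous_intros)+
  have "closed K" unfolding K_def
    by (intro closed_Int closed_Collect_eq contN contL continuous_intros)
  moreover have "bounded K"
  proof -
    define m where "m = Min (range d)"
    have m: "0 < m" "\<And>i. m \<le> d i" using d by (auto simp: m_def)
    have "norm v \<le> sqrt (1 / m)" if "v \<in> K" for v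
    proof -
      have "m * (norm v)\<^sup>2 = (\<Sum>i\<in>UNIV. m * (v $ i)\<^sup>2)"
        by (simp add: norm_vec_def L2_set_def sum_nonneg sum_distrib_left)
      also have "\<dots> \<le> N v" unfolding N_def by (intro sum_mono mult_right_mono m) auto
      also have "\<dots> = 1" using that by (simp add: K_def)
      finally have "(norm v)\<^sup>2 \<le> 1 / m" using m by (simp add: field_simps)
      then show ?thesis by (rule real_le_rsqrt)
    qed
    then show ?thesis by (auto simp: bounded_iff)
  qed
  ultimately have "compact K" by (simp add: compact_eq_bounded_closed)
  have v0_nz: "v0 \<noteq> 0" using pos bilinear_lzero[OF B] by auto
  define v1 where "v1 = (1 / sqrt (N v0)) *\<^sub>R v0"
  have v1: "v1 \<in> K" "0 < B v1 v1"
    using N_pos[OF v0_nz] v0 pos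
    by (simp_all add: K_def v1_def N_scale L_scale L_def[symmetric] bil power_divide)
  obtain v where v: "v \<in> K" "\<And>u. u \<in> K \<Longrightarrow> B u u \<le> B v v"
    using continuous_attains_sup[OF \<open>compact K\<close> _ contB] v1 by auto
  define \<mu> where "\<mu> = B v v"
  have \<mu>: "0 < \<mu>" using v(2)[OF v1(1)] v1(2) by (simp add: \<mu>_def)
  have max: "B u u \<le> \<mu> * N u" if "L u = 0" for u
  proof (cases "u = 0")
    case False
    then have "(1 / sqrt (N u)) *\<^sub>R u \<in> K"
      using N_pos[OF False] that by (simp add: K_def N_scale L_scale power_divide)
    from v(2)[OF this] show ?thesis
      using N_pos[OF False] by (simp add: bil \<mu>_def field_simps)
  qed (simp add: bilinear_lzero[OF B] N_def)
  have eig: "B u v = \<mu> * (\<Sum>i\<in>UNIV. d i * u $ i * v $ i)" if u: "L u = 0" for u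
  proof -
    define C where "C = B u v - \<mu> * (\<Sum>i\<in>UNIV. d i * u $ i * v $ i)"
    define E where "E = B u u - \<mu> * N u"
    \<comment> \<open>Maximality at \<open>v + t *\<^sub>R u\<close>; the constant terms cancel
      because \<open>B v v = \<mu>\<close> and \<open>N v = 1\<close>.\<close>
    have *: "2 * t * C + t\<^sup>2 * E \<le> 0" for t
    proof -
      have "L (v + t *\<^sub>R u) = L v + t * L u"
        by (simp add: L_def sum.distrib sum_distrib_left algebra_simps)
      then have "L (v + t *\<^sub>R u) = 0" using u v(1) by (simp add: K_def)
      then have "B (v + t *\<^sub>R u) (v + t *\<^sub>R u) \<le> \<mu> * N (v + t *\<^sub>R u)" by (rule max)
      moreover have "N (v + t *\<^sub>R u) = N v + 2 * t * (\<Sum>i\<in>UNIV. d i * u $ i * v $ i) + t\<^sup>2 * N u"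
        by (simp add: N_def sum.distrib[symmetric] sum_distrib_left power2_eq_square algebra_simps)
      moreover have "B (v + t *\<^sub>R u) (v + t *\<^sub>R u) = \<mu> + 2 * t * B u v + t\<^sup>2 * B u u"
        by (simp add: bil \<mu>_def sym[of v u] power2_eq_square algebra_simps)
      ultimately show ?thesis
        using v(1) by (simp add: K_def C_def E_def algebra_simps)
    qed
    have "E \<le> 0" using max[OF u] by (simp add: E_def)
    have "C = 0"
    proof (rule ccontr)
      assume "C \<noteq> 0"
      \<comment> \<open>The denominator is positive since \<open>E \<le> 0\<close>. This choice
        turns the quadratic expression into \<open>t\<^sup>2 * (2 - E)\<close>, which is positive
        unless \<open>C = 0\<close>.\<close>
      define t where "t = C / (1 - E)"
      have C: "C = t * (1 - E)" using \<open>E \<le> 0\<close> by (simp add: t_def)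
      have "2 * t * C + t\<^sup>2 * E = t\<^sup>2 * (2 - E)"
        unfolding C by (simp add: algebra_simps power2_eq_square)
      moreover have "0 < t\<^sup>2 * (2 - E)" using \<open>E \<le> 0\<close> \<open>C \<noteq> 0\<close> C by simp
      ultimately show False using *[of t] by simp
    qed
    then show ?thesis by (simp add: C_def)
  qed
  show ?thesis
  proof (intro exI[of _ v] exI[of _ \<mu>] conjI allI impI)
    show "v \<noteq> 0" using v(1) by (auto simp: K_def N_def)
    show "B v v = \<mu> * (\<Sum>i\<in>UNIV. d i * (v $ i)\<^sup>2)" using v(1) by (simp add: K_def N_def \<mu>_def)
  qed (use \<mu> v(1) eig in \<open>auto simp: K_def L_def\<close>)
qed

text \<open>
  A term of the sum in \<open>local\<close> with \<open>r i = 0\<close> is \<open>0\<close> by the convention \<open>x / 0 = 0\<close>; this is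
  harmless, since then the whole row \<open>i\<close> of \<open>B\<close> vanishes.
\<close>

lemma trickle_down:
  fixes B :: "real ^ 'n \<Rightarrow> real ^ 'n \<Rightarrow> real" and x :: "real ^ 'n"
  defines "r \<equiv> \<lambda>i. B (axis i 1) x"
  assumes B: "bilinear B" and sym: "\<And>v w. B v w = B w v"
    and nonneg: "\<And>i j. 0 \<le> B (axis i 1) (axis j 1)"
    and x: "\<And>i. 0 < x $ i"
    and local: "\<And>v. B v v \<le> (\<Sum>i\<in>UNIV. x $ i * (B (axis i 1) v)\<^sup>2 / r i)"
    and conn: "\<And>(c :: 'n \<Rightarrow> real) i j. (\<And>i j. B (axis i 1) (axis j 1) \<noteq> 0 \<Longrightarrow> c i = c j) \<Longrightarrow>
       r i \<noteq> 0 \<Longrightarrow> r j \<noteq> 0 \<Longrightarrow> c i = c j"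
    and v: "B x v = 0"
  shows "B v v \<le> 0"
proof (rule ccontr)
  assume "\<not> B v v \<le> 0"
  note expand = bilinear_axis_expand[OF B]
  have expand': "B w u = (\<Sum>j\<in>UNIV. u $ j * B w (axis j 1))" for w u
    by (subst (1 2) sym) (rule expand)
  have r: "r i = (\<Sum>j\<in>UNIV. x $ j * B (axis i 1) (axis j 1))" for i
    unfolding r_def by (rule expand')
  have r_nonneg: "0 \<le> r i" for i unfolding r using nonneg x by (intro sum_nonneg) (simp add: less_imp_le)
  have r0: "B (axis i 1) u = 0" if "r i = 0" for i u
  proof -
    have "\<forall>j\<in>UNIV. x $ j * B (axis i 1) (axis j 1) = 0"
      using that unfolding r by (subst sum_nonneg_eq_0_iff[symmetric]) (auto simp: nonneg x less_imp_le)
    then have "B (axis i 1) (axis j 1) = 0" for j using x[of j] by (metis UNIV_I less_irrefl mult_eq_0_iff)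
    then show ?thesis by (subst expand') simp
  qed
  have Bx: "B x u = (\<Sum>i\<in>UNIV. r i * u $ i)" for u
    unfolding r_def by (subst expand') (simp add: sym[of x] mult.commute)
  \<comment> \<open>The diagonal matrix of the eigenvalue problem. On zero rows the value 1 keeps
    all weights positive; the eigenvector vanishes there by \<open>off\<close>.\<close>
  define d where "d i = (if r i = 0 then 1 else r i / x $ i)" for i
  have d: "0 < d i" for i using r_nonneg[of i] x[of i] by (auto simp: d_def)
  have "(\<Sum>i\<in>UNIV. r i * v $ i) = 0" using v Bx by simp
  moreover have "0 < B v v" using \<open>\<not> B v v \<le> 0\<close> by simp
  ultimately have "\<exists>v \<mu>. 0 < \<mu> \<and> v \<noteq> 0 \<and> (\<Sum>i\<in>UNIV. r i * v $ i) = 0 \<and>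
    B v v = \<mu> * (\<Sum>i\<in>UNIV. d i * (v $ i)\<^sup>2) \<and>
    (\<forall>u. (\<Sum>i\<in>UNIV. r i * u $ i) = 0 \<longrightarrow> B u v = \<mu> * (\<Sum>i\<in>UNIV. d i * u $ i * v $ i))"
    by (rule bilinear_max_constrained[where B = B and d = d, OF B sym d])
  then obtain v \<mu> where \<mu>: "0 < \<mu>" and nz: "v \<noteq> 0" and Lv: "(\<Sum>i\<in>UNIV. r i * v $ i) = 0"
    and vv: "B v v = \<mu> * (\<Sum>i\<in>UNIV. d i * (v $ i)\<^sup>2)"
    and eig: "\<And>u. (\<Sum>i\<in>UNIV. r i * u $ i) = 0 \<Longrightarrow> B u v = \<mu> * (\<Sum>i\<in>UNIV. d i * u $ i * v $ i)"
    by blast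
  define N where "N = (\<Sum>i\<in>UNIV. d i * (v $ i)\<^sup>2)"
  have sum_axis: "(\<Sum>k\<in>UNIV. a k * axis i (1::real) $ k * b k) = a i * b i"
    "(\<Sum>k\<in>UNIV. a k * axis i (1::real) $ k) = a i" for a b :: "'n \<Rightarrow> real" and i
    by (simp_all add: axis_def if_distrib if_distribR cong: if_cong)
  have off: "v $ i = 0" if "r i = 0" for i
    using eig[of "axis i 1"] that r0[OF that, of v] d[of i] \<mu> by (simp add: sum_axis)
  have rd: "r i * v $ i = d i * x $ i * v $ i" for i
    using off x[of i] by (auto simp: d_def)
  \<comment> \<open>The equation \<open>eig\<close> holds only for test vectors in the kernel of
    \<open>r\<close>. Subtracting a multiple of \<open>x\<close> moves \<open>axis i 1\<close> into
    this kernel and changes neither side: by \<open>Bx\<close>, \<open>rd\<close> and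
    \<open>Lv\<close>, the vector \<open>x\<close> is orthogonal to \<open>v\<close> for
    \<open>B\<close> and for the weights \<open>d\<close>.\<close>
  have eigen: "B (axis i 1) v = \<mu> * d i * v $ i" for i
  proof (cases "r i = 0")
    case False
    define X where "X = B x x"
    have X: "X = (\<Sum>i\<in>UNIV. r i * x $ i)" by (simp add: X_def Bx)
    have "0 < X" unfolding X using False r_nonneg x
      by (intro sum_pos2[where i = i]) (auto simp: less_imp_le less_le)
    define u where "u = axis i 1 - (r i / X) *\<^sub>R x"
    have "(\<Sum>k\<in>UNIV. r k * u $ k) = r i - (r i / X) * X"
      unfolding u_def X
      by (simp add: right_diff_distrib sum_subtractf sum_axis sum_distrib_left mult.left_commute)
    then have "B u v = \<mu> * (\<Sum>k\<in>UNIV. d k * u $ k * v $ k)" using \<open>0 < X\<close> by (intro eig) simp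
    moreover have "B u v = B (axis i 1) v"
      using Bx[of v] Lv by (simp add: u_def bilinear_lsub[OF B] bilinear_lmul[OF B])
    moreover have "(\<Sum>k\<in>UNIV. d k * u $ k * v $ k) = d i * v $ i - (r i / X) * (\<Sum>k\<in>UNIV. d k * x $ k * v $ k)"
      unfolding u_def
      by (simp add: algebra_simps sum_subtractf sum_axis sum_distrib_left sum_axis(1)[simplified mult_ac])
    moreover have "(\<Sum>k\<in>UNIV. d k * x $ k * v $ k) = 0" using Lv by (simp add: rd)
    ultimately show ?thesis by simp
  qed (simp add: r0 off)
  \<comment> \<open>Inserting the eigenvector into \<open>local\<close> yields \<mu> \<le> \<mu>^2
    after division by \<open>N\<close>.\<close>
  have "\<mu> * N \<le> (\<Sum>i\<in>UNIV. x $ i * (\<mu> * d i * v $ i)\<^sup>2 / r i)"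
    using local[of v] by (simp add: eigen vv N_def)
  also have "\<dots> = (\<Sum>i\<in>UNIV. \<mu>\<^sup>2 * (d i * (v $ i)\<^sup>2))"
  proof (rule sum.cong[OF refl])
    fix i show "x $ i * (\<mu> * d i * v $ i)\<^sup>2 / r i = \<mu>\<^sup>2 * (d i * (v $ i)\<^sup>2)"
      using x[of i] off[of i] by (cases "r i = 0") (auto simp: d_def power2_eq_square)
  qed
  also have "\<dots> = \<mu>\<^sup>2 * N" by (simp add: N_def sum_distrib_left)
  finally have "\<mu> * N \<le> \<mu>\<^sup>2 * N" .
  moreover have "0 < N"
  proof -
    obtain i where "v $ i \<noteq> 0" using vec_nonzeroD[OF nz] by blast
    then show ?thesis unfolding N_def using d by (intro sum_pos2[where i = i]) (auto simp: less_imp_le)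
  qed
  ultimately have "1 \<le> \<mu>" using \<mu> by (simp add: power2_eq_square)
  \<comment> \<open>These nonnegative terms add up to \<open>2 N (1 - \<mu>)\<close>, so \<open>\<mu> = 1\<close> and the ratios \<open>v\<^sub>i / x\<^sub>i\<close> agree
    along every edge.\<close>
  define h where "h i j = B (axis i 1) (axis j 1) * (x $ i * x $ j) * (v $ i / x $ i - v $ j / x $ j)\<^sup>2" for i j
  have h_nonneg: "0 \<le> h i j" for i j using nonneg x by (simp add: h_def less_imp_le)
  \<comment> \<open>Expanded square: summed over all pairs, each of the first two terms gives
    \<open>N\<close>, since \<open>r\<close> consists of the row sums weighted by \<open>x\<close>,
    and the last one gives \<open>2 * B v v\<close>.\<close>
  have h_eq: "h i j = x $ j * B (axis i 1) (axis j 1) * ((v $ i)\<^sup>2 / x $ i)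
      + x $ i * B (axis j 1) (axis i 1) * ((v $ j)\<^sup>2 / x $ j)
      - 2 * (v $ i * (v $ j * B (axis i 1) (axis j 1)))" for i j
    using x[of i] x[of j] by (simp add: h_def sym[of "axis j 1" "axis i 1"] field_simps power2_eq_square)
  have rsum: "(\<Sum>i\<in>UNIV. r i * ((v $ i)\<^sup>2 / x $ i)) = N"
    unfolding N_def using off by (intro sum.cong refl) (auto simp: d_def)
  have "(\<Sum>i\<in>UNIV. \<Sum>j\<in>UNIV. h i j) = N + N - 2 * B v v"
  proof -
    have "(\<Sum>i\<in>UNIV. \<Sum>j\<in>UNIV. x $ j * B (axis i 1) (axis j 1) * ((v $ i)\<^sup>2 / x $ i)) = N"
      unfolding rsum[symmetric] r by (simp add: sum_distrib_right del: times_divide_eq_right)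
    moreover from this
    have "(\<Sum>i\<in>UNIV. \<Sum>j\<in>UNIV. x $ i * B (axis j 1) (axis i 1) * ((v $ j)\<^sup>2 / x $ j)) = N"
      by (subst sum.swap)
    moreover have "(\<Sum>i\<in>UNIV. \<Sum>j\<in>UNIV. 2 * (v $ i * (v $ j * B (axis i 1) (axis j 1)))) = 2 * B v v"
      by (subst expand, subst expand') (simp add: sum_distrib_left)
    ultimately show ?thesis by (simp add: h_eq sum.distrib sum_subtractf)
  qed
  also have "\<dots> = 2 * N * (1 - \<mu>)" using vv by (simp add: N_def algebra_simps)
  also have "\<dots> \<le> 0" using \<open>0 < N\<close> \<open>1 \<le> \<mu>\<close> by (simp add: mult_le_0_iff)
  finally have "(\<Sum>i\<in>UNIV. \<Sum>j\<in>UNIV. h i j) = 0"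
    using h_nonneg by (intro antisym sum_nonneg) auto
  then have h0: "h i j = 0" for i j
    using h_nonneg by (simp add: sum_nonneg_eq_0_iff sum_nonneg)
  have const: "v $ i / x $ i = v $ j / x $ j" if "r i \<noteq> 0" "r j \<noteq> 0" for i j
  proof (rule conn[OF _ that])
    fix i j assume "B (axis i 1) (axis j 1) \<noteq> 0"
    with h0[of i j] x[of i] x[of j] show "v $ i / x $ i = v $ j / x $ j" by (simp add: h_def)
  qed
  obtain k where "v $ k \<noteq> 0" using vec_nonzeroD[OF nz] by blast
  then have "r k \<noteq> 0" using off by auto
  \<comment> \<open>On the support of \<open>r\<close> the vector \<open>v\<close> is a nonzero
    multiple of the positive vector \<open>x\<close>, which the constraint \<open>Lv\<close>
    excludes.\<close>
  have "(\<Sum>i\<in>UNIV. r i * v $ i) = (\<Sum>i\<in>UNIV. v $ k / x $ k * (r i * x $ i))"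
  proof (rule sum.cong[OF refl])
    fix i show "r i * v $ i = v $ k / x $ k * (r i * x $ i)"
    proof (cases "r i = 0")
      case False
      show ?thesis unfolding const[OF \<open>r k \<noteq> 0\<close> False] using x[of i] by simp
    qed simp
  qed
  also have "\<dots> = v $ k / x $ k * (\<Sum>i\<in>UNIV. r i * x $ i)" by (simp add: sum_distrib_left)
  finally have "(\<Sum>i\<in>UNIV. r i * x $ i) = 0" using Lv \<open>v $ k \<noteq> 0\<close> x[of k] by simp
  moreover have "0 < (\<Sum>i\<in>UNIV. r i * x $ i)" using \<open>r k \<noteq> 0\<close> r_nonneg x
    by (intro sum_pos2[where i = k]) (auto simp: less_imp_le less_le)
  ultimately show False by simp
qed

section \<open>The Alexandrov-Fenchel inequality for mixed derivatives\<close>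

text \<open>Connectedness of the hypergraph whose edges are the sets with
  \<open>h S \<noteq> 0\<close>; vertices in no edge are ignored.\<close>

definition connected_support :: "('n set \<Rightarrow> real) \<Rightarrow> bool" where
  "connected_support h \<longleftrightarrow>
     (\<forall>C. (\<forall>S. h S \<noteq> 0 \<longrightarrow> S \<subseteq> C \<or> S \<inter> C = {}) \<longrightarrow>
        (\<forall>S. h S \<noteq> 0 \<longrightarrow> S \<subseteq> C) \<or> (\<forall>S. h S \<noteq> 0 \<longrightarrow> S \<inter> C = {}))"

text \<open>In contrast to a condition on the number of positive eigenvalues, this inequality passes
  to limits directly.\<close>

definition hyperbolic_form :: "(real ^ 'n \<Rightarrow> real ^ 'n \<Rightarrow> real) \<Rightarrow> bool" where
  "hyperbolic_form B \<longleftrightarrow> (\<forall>v y. (\<forall>i. 0 \<le> y $ i) \<longrightarrow> B v v * B y y \<le> (B v y)\<^sup>2)"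

text \<open>A set \<open>C\<close> that separates the support splits \<open>gen_poly h\<close> into
  the monomials inside \<open>C\<close> and the remaining ones, two nonzero polynomials in disjoint
  variables.\<close>

lemma connected_support_of_indecomposable:
  assumes ind: "indecomposable_set_fun h" and h0: "h {} = 0"
  shows "connected_support h"
proof (rule ccontr)
  assume "\<not> connected_support h"
  then obtain C S1 S2 where C: "\<And>S. h S \<noteq> 0 \<Longrightarrow> S \<subseteq> C \<or> S \<inter> C = {}"
    and S1: "h S1 \<noteq> 0" "\<not> S1 \<subseteq> C" and S2: "h S2 \<noteq> 0" "S2 \<inter> C \<noteq> {}"
    unfolding connected_support_def by blast
  define q where "q = gen_poly (\<lambda>S. if S \<subseteq> C then h S else 0)"
  define r where "r = gen_poly (\<lambda>S. if S \<subseteq> C then 0 else h S)"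
  have "gen_poly h = q + r"
    by (rule poly_mapping_eqI) (simp add: q_def r_def lookup_add lookup_gen_poly)
  moreover have "q \<noteq> 0"
  proof
    assume "q = 0"
    then have "Poly_Mapping.lookup q (set_monom S2) = 0" by simp
    then show False using C[OF S2(1)] S2 by (simp add: q_def lookup_gen_poly_set_monom)
  qed
  moreover have "r \<noteq> 0"
  proof
    assume "r = 0"
    then have "Poly_Mapping.lookup r (set_monom S1) = 0" by simp
    then show False using S1 by (simp add: r_def lookup_gen_poly_set_monom)
  qed
  moreover have "poly_vars q \<inter> poly_vars r = {}"
    using C by (fastforce simp: poly_vars_def q_def r_def keys_gen_poly split: if_splits)
  moreover have "Poly_Mapping.lookup q 0 = 0"
    using lookup_gen_poly_set_monom[of "\<lambda>S. if S \<subseteq> C then h S else 0" "{}"] h0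
    by (simp add: q_def set_monom_def)
  ultimately show False
    using ind unfolding indecomposable_set_fun_def decomposable_poly_def by blast
qed

lemma link_link_singleton:
  "link (link h {i}) \<tau> = (if i \<in> \<tau> then (\<lambda>_. 0) else link h (insert i \<tau>))"
  by (auto simp: link_def fun_eq_iff)

text \<open>Induction with the first direction \<open>x\<close> split off and the links of single
  elements as smaller instances. Strict positivity gives \<open>x\<close> the positive entries that
  \<open>trickle_down\<close> requires, and makes \<open>D i x x\<close> positive for every
  \<open>i\<close> that occurs in the support.\<close>

lemma hyperbolic_form_mixed_pos:
  assumes "\<And>S. 0 \<le> h S" "homogeneous_set_fun (length as + 2) h"
    and "\<And>\<tau>. card \<tau> \<le> length as \<Longrightarrow> connected_support (link h \<tau>)"
    and "\<And>\<tau>. card \<tau> = length as \<Longrightarrow> hyperbolic_form (\<lambda>v w. dderiv v (dderiv w (link h \<tau>)) {})"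
    and "\<And>a i. a \<in> set as \<Longrightarrow> 0 < a $ i"
  shows "hyperbolic_form (\<lambda>v w. foldr dderiv as (dderiv v (dderiv w h)) {})"
  using assms
proof (induction as arbitrary: h)
  case Nil
  from Nil(4)[of "{}"] show ?case by (simp add: link_empty)
next
  case (Cons x as)
  note h_nonneg = Cons.prems(1) and hom = Cons.prems(2)
  have x: "0 < x $ i" for i using Cons.prems(5) by simp
  have as: "0 < a $ i" if "a \<in> set as" for a i using Cons.prems(5) that by simp
  define B where "B v w = foldr dderiv (x # as) (dderiv v (dderiv w h)) {}" for v w
  define D where "D i v w = foldr dderiv as (dderiv v (dderiv w (link h {i}))) {}" for i v w
  have B: "bilinear B" unfolding B_def by (rule bilinear_foldr_dderiv)
  have sym: "B v w = B w v" for v w unfolding B_def by (simp only: dderiv_commute)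
  \<comment> \<open>Both sides are the same mixed derivative in \<open>axis i 1\<close>,
    \<open>v\<close>, \<open>x\<close> and the directions of \<open>as\<close>; only the order
    differs.\<close>
  have D_x: "D i v x = B (axis i 1) v" for i v
    unfolding B_def D_def dderiv_axis[symmetric] foldr.simps o_apply foldr_dderiv_commute[symmetric]
    by (metis dderiv_commute)
  have B_D: "B v w = (\<Sum>i\<in>UNIV. x $ i * D i v w)" for v w
  proof -
    have "B v w = foldr dderiv as (dderiv x (dderiv v (dderiv w h))) {}"
      unfolding B_def foldr.simps o_apply foldr_dderiv_commute[symmetric] ..
    also have "\<dots> = (\<Sum>i\<in>UNIV. x $ i * foldr dderiv as (dderiv (axis i 1) (dderiv v (dderiv w h))) {})"
      by (rule foldr_dderiv_expand)
    also have "\<dots> = (\<Sum>i\<in>UNIV. x $ i * D i v w)"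
      unfolding D_def dderiv_axis[symmetric] by (metis dderiv_commute)
    finally show ?thesis .
  qed
  have D_hyp: "hyperbolic_form (D i)" for i
    unfolding D_def
  proof (rule Cons.IH)
    show "0 \<le> link h {i} S" for S by (simp add: link_def h_nonneg)
    show "homogeneous_set_fun (length as + 2) (link h {i})"
      by (rule homogeneous_link_singleton) (use hom in simp)
    fix \<tau> :: "'a set"
    have zero: "connected_support (\<lambda>_ :: 'a set. 0)" "hyperbolic_form (\<lambda>v w :: real ^ 'a. 0)"
      by (simp_all add: connected_support_def hyperbolic_form_def)
    have card: "card (insert i \<tau>) = Suc (card \<tau>)" if "i \<notin> \<tau>" using that by simp
    \<comment> \<open>For \<open>i \<in> \<tau>\<close> the iterated link is zero; otherwise it is
      the link of \<open>insert i \<tau>\<close>, whose cardinality fits the longer list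
      \<open>x # as\<close>.\<close>
    show "connected_support (link (link h {i}) \<tau>)" if "card \<tau> \<le> length as"
      using Cons.prems(3)[of "insert i \<tau>"] that card by (auto simp: link_link_singleton zero)
    show "hyperbolic_form (\<lambda>v w. dderiv v (dderiv w (link (link h {i}) \<tau>)) {})" if "card \<tau> = length as"
      using Cons.prems(4)[of "insert i \<tau>"] that card
      by (auto simp: link_link_singleton zero)
  qed (use as in auto)
  have nonneg: "0 \<le> B v w" if "\<And>i. 0 \<le> v $ i" "\<And>i. 0 \<le> w $ i" for v w
  proof -
    have "0 \<le> foldr dderiv ((x # as) @ [v, w]) h {}"
    proof (rule foldr_dderiv_nonneg)
      fix a i assume "a \<in> set ((x # as) @ [v, w])"
      then show "0 \<le> a $ i" using x as that by (auto simp: less_imp_le)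
    qed (rule h_nonneg)
    then show ?thesis by (simp add: B_def)
  qed
  have pos: "0 < D i x x" if "i \<in> T" "h T \<noteq> 0" for i T
  proof -
    have "0 < h T" using h_nonneg[of T] that by simp
    moreover have "card T = length as + 3" using hom that by (auto simp: homogeneous_set_fun_def)
    ultimately have "0 < foldr dderiv (as @ [x, x]) (link h {i}) {}"
      using that
      by (intro foldr_dderiv_pos[where T = "T - {i}"])
        (auto simp: link_def h_nonneg as x insert_absorb)
    then show ?thesis by (simp add: D_def)
  qed
  have edge: "0 < B (axis i 1) (axis j 1)" if "i \<in> T" "j \<in> T" "i \<noteq> j" "h T \<noteq> 0" for i j T
  proof -
    have "0 < h T" using h_nonneg[of T] that by simp
    moreover have "card T = length as + 3" using hom that by (auto simp: homogeneous_set_fun_def)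
    moreover have "insert j (insert i (T - {i, j})) = T" using that by auto
    ultimately have "0 < foldr dderiv (x # as) (link (link h {j}) {i}) {}"
      using that
      by (intro foldr_dderiv_pos[where T = "T - {i, j}"])
        (auto simp: link_def h_nonneg as x card_Diff_subset)
    then show ?thesis by (simp add: B_def dderiv_axis)
  qed
  have neg: "B v v \<le> 0" if "B x v = 0" for v
  proof (rule trickle_down[OF B sym _ x _ _ that])
    show "0 \<le> B (axis i 1) (axis j 1)" for i j
      by (rule nonneg) (simp_all add: axis_def)
    fix u
    \<comment> \<open>The inequality for \<open>D i\<close> at \<open>y = x\<close>, divided by
      \<open>D i x x\<close>, which equals \<open>B (axis i 1) x\<close> by
      \<open>D_x\<close>.\<close>
    have "D i u u \<le> (B (axis i 1) u)\<^sup>2 / B (axis i 1) x" for i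
    proof (cases "\<exists>T. i \<in> T \<and> h T \<noteq> 0")
      case True
      then have "0 < D i x x" using pos by blast
      moreover have "D i u u * D i x x \<le> (D i u x)\<^sup>2"
        using D_hyp x by (simp add: hyperbolic_form_def less_imp_le)
      ultimately show ?thesis by (simp add: D_x field_simps)
    next
      case False
      then have "link h {i} = (\<lambda>_. 0)" by (auto simp: link_def fun_eq_iff)
      then have "D i u u = 0" by (simp add: D_def)
      then show ?thesis using nonneg[of "axis i 1" x] x by (simp add: axis_def less_imp_le)
    qed
    then have "x $ i * D i u u \<le> x $ i * (B (axis i 1) u)\<^sup>2 / B (axis i 1) x" for i
      using x[of i] by (metis less_imp_le mult_left_mono times_divide_eq_right)
    then show "B u u \<le> (\<Sum>i\<in>UNIV. x $ i * (B (axis i 1) u)\<^sup>2 / B (axis i 1) x)"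
      unfolding B_D[of u u] by (intro sum_mono)
  next
    fix c :: "'a \<Rightarrow> real" and i j
    assume c: "\<And>i j. B (axis i 1) (axis j 1) \<noteq> 0 \<Longrightarrow> c i = c j"
      and ij: "B (axis i 1) x \<noteq> 0" "B (axis j 1) x \<noteq> 0"
    have ex: "\<exists>T. k \<in> T \<and> h T \<noteq> 0" if "B (axis k 1) x \<noteq> 0" for k
    proof (rule ccontr)
      assume "\<nexists>T. k \<in> T \<and> h T \<noteq> 0"
      then have "link h {k} = (\<lambda>_. 0)" by (auto simp: link_def fun_eq_iff)
      then have "D k x x = 0" by (simp add: D_def)
      with that show False by (simp add: D_x)
    qed
    \<comment> \<open>Any two elements of a support set form an edge of \<open>B\<close>, so
      \<open>c\<close> is constant on it. Hence each level set of \<open>c\<close> contains or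
      misses every support set, and connectedness applies.\<close>
    have same: "c k = c l" if "k \<in> T" "l \<in> T" "h T \<noteq> 0" for k l T
    proof (cases "k = l")
      case False
      from edge[OF that(1,2) False that(3)] show ?thesis by (intro c) simp
    qed simp
    define C where "C = {k. c k = c i}"
    obtain T U where T: "i \<in> T" "h T \<noteq> 0" and U: "j \<in> U" "h U \<noteq> 0"
      using ex[OF ij(1)] ex[OF ij(2)] by blast
    have "connected_support h" using Cons.prems(3)[of "{}"] by (simp add: link_empty)
    moreover have "S \<subseteq> C \<or> S \<inter> C = {}" if "h S \<noteq> 0" for S
    proof (cases "S \<inter> C = {}")
      case False
      then obtain k where "k \<in> S" "c k = c i" unfolding C_def by auto
      have "l \<in> C" if "l \<in> S" for l
        using same[OF that \<open>k \<in> S\<close> \<open>h S \<noteq> 0\<close>] \<open>c k = c i\<close> unfolding C_def by simp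
      then show ?thesis by blast
    qed simp
    ultimately have "(\<forall>S. h S \<noteq> 0 \<longrightarrow> S \<subseteq> C) \<or> (\<forall>S. h S \<noteq> 0 \<longrightarrow> S \<inter> C = {})"
      unfolding connected_support_def by blast
    moreover have "i \<in> C" by (simp add: C_def)
    ultimately have "j \<in> C" using T U by blast
    then show "c i = c j" by (simp add: C_def)
  qed
  have "linear (B x)" using B by (simp add: bilinear_def)
  show ?case
    unfolding hyperbolic_form_def B_def[symmetric]
    by (intro allI impI bilinear_hyperbolic[OF B sym \<open>linear (B x)\<close> neg] nonneg) auto
qed

text \<open>Adding a small positive multiple of the all-ones vector makes all directions strictly
  positive; the inequality survives the limit.\<close>

lemma hyperbolic_form_mixed:
  assumes "\<And>S. 0 \<le> h S" "homogeneous_set_fun (length as + 2) h"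
    and "\<And>\<tau>. card \<tau> \<le> length as \<Longrightarrow> connected_support (link h \<tau>)"
    and "\<And>\<tau>. card \<tau> = length as \<Longrightarrow> hyperbolic_form (\<lambda>v w. dderiv v (dderiv w (link h \<tau>)) {})"
    and as: "\<And>a i. a \<in> set as \<Longrightarrow> 0 \<le> a $ i"
  shows "hyperbolic_form (\<lambda>v w. foldr dderiv as (dderiv v (dderiv w h)) {})"
  unfolding hyperbolic_form_def
proof (intro allI impI)
  fix v y :: "real ^ 'a" assume y: "\<forall>i. 0 \<le> y $ i"
  define F where "F e u w = foldr dderiv (map (\<lambda>a. a + e *\<^sub>R 1) as) (dderiv u (dderiv w h)) {}" for e u w
  have lim: "((\<lambda>e. F e u w) \<longlongrightarrow> foldr dderiv as (dderiv u (dderiv w h)) {}) (at_right 0)" for u w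
    unfolding F_def by (rule tendsto_foldr_dderiv)
  have ev: "eventually (\<lambda>e. F e v v * F e y y \<le> (F e v y)\<^sup>2) (at_right 0)"
    using eventually_at_right_less[of "0 :: real"]
  proof eventually_elim
    case (elim e)
    have "hyperbolic_form (F e)"
      unfolding F_def
    proof (rule hyperbolic_form_mixed_pos)
      fix a i assume "a \<in> set (map (\<lambda>a. a + e *\<^sub>R (1 :: real ^ 'a)) as)"
      then show "0 < a $ i" using as elim by (auto intro!: add_nonneg_pos)
    qed (use assms in auto)
    then show ?case using y by (simp add: hyperbolic_form_def)
  qed
  show "foldr dderiv as (dderiv v (dderiv v h)) {} * foldr dderiv as (dderiv y (dderiv y h)) {}
      \<le> (foldr dderiv as (dderiv v (dderiv y h)) {})\<^sup>2"
    by (rule tendsto_le[OF _ _ _ ev]) (auto intro!: tendsto_intros lim)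
qed

section \<open>Coverage functions\<close>

text \<open>Off the diagonal the matrix of the form on \<open>S\<close> is
  \<open>b i + b j - W i j\<close>. The first two summands vanish on vectors with coordinate sum 0
  over \<open>S\<close>, and \<open>W\<close>, the measures of the sets
  \<open>A i \<inter> A j\<close>, is a positive semidefinite Gram matrix.\<close>

lemma hyperbolic_form_coverage:
  assumes cov: "coverage_on S g" and lin: "linear_set_fun_on S l"
    and lg: "\<And>i. i \<in> S \<Longrightarrow> l {i} \<le> g {i}"
    and h_nonneg: "\<And>T. 0 \<le> h T"
    and h: "\<And>T. card T = 2 \<Longrightarrow> h T = (if T \<subseteq> S then g T - l T / 2 else 0)"
  shows "hyperbolic_form (\<lambda>v w. dderiv v (dderiv w h) {})"
proof -
  define B where "B v w = dderiv v (dderiv w h) {}" for v w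
  have B: "bilinear B" using bilinear_foldr_dderiv[of "[]" h "{}"] unfolding B_def by simp
  have sym: "B v w = B w v" for v w unfolding B_def by (simp only: dderiv_commute)
  obtain U :: "nat set" and A w where U: "finite U" and A': "\<forall>i\<in>S. A i \<subseteq> U"
    and w': "\<forall>u\<in>U. 0 \<le> w u" and g': "\<forall>T\<subseteq>S. g T = (\<Sum>u\<in>(\<Union>i\<in>T. A i). w u)"
    using cov unfolding coverage_on_def by blast
  have A: "A i \<subseteq> U" if "i \<in> S" for i using A' that by blast
  have w: "0 \<le> w u" if "u \<in> U" for u using w' that by blast
  have g: "g T = (\<Sum>u\<in>(\<Union>i\<in>T. A i). w u)" if "T \<subseteq> S" for T using g' that by blast
  define a where "a i u = (if u \<in> A i then 1 else 0 :: real)" for i u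
  define W where "W i j = (\<Sum>u\<in>U. w u * (a i u * a j u))" for i j
  define b where "b i = g {i} - l {i} / 2" for i
  have gi: "g {i} = (\<Sum>u\<in>U. w u * a i u)" if "i \<in> S" for i
    using that U A[of i] by (simp add: g a_def if_distrib sum.If_cases Int_absorb1 cong: if_cong)
  have W_diag: "W i i = g {i}" if "i \<in> S" for i
    unfolding W_def gi[OF that] by (intro sum.cong) (auto simp: a_def)
  have gij: "g {i, j} = g {i} + g {j} - W i j" if "i \<in> S" "j \<in> S" for i j
  proof -
    have "U \<inter> {u. u \<in> A i \<union> A j} = A i \<union> A j" using that A[of i] A[of j] by blast
    then have "g {i, j} = (\<Sum>u\<in>U. w u * (if u \<in> A i \<union> A j then 1 else 0))"
      using that U A[of i] A[of j]
      by (simp add: g if_distrib sum.If_cases cong: if_cong del: Un_iff)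
    also have "\<dots> = (\<Sum>u\<in>U. w u * a i u + w u * a j u - w u * (a i u * a j u))"
      by (intro sum.cong) (auto simp: a_def)
    finally show ?thesis by (simp add: gi that W_def sum.distrib sum_subtractf)
  qed
  have hij: "h {i, j} = (if i \<in> S \<and> j \<in> S then b i + b j - W i j else 0)" if "i \<noteq> j" for i j
  proof -
    have "l {i, j} = l {i} + l {j}" if "i \<in> S" "j \<in> S"
    proof -
      have "{i, j} \<subseteq> S" using that by simp
      with lin have "l {i, j} = (\<Sum>k\<in>{i, j}. l {k})" unfolding linear_set_fun_on_def by blast
      then show ?thesis using \<open>i \<noteq> j\<close> by simp
    qed
    then show ?thesis using h[of "{i, j}"] that gij[of i j]
      by (cases "i \<in> S \<and> j \<in> S") (auto simp: b_def field_simps)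
  qed
  define \<phi> where "\<phi> v = (\<Sum>i\<in>S. v $ i)" for v :: "real ^ 'a"
  have "linear \<phi>" unfolding \<phi>_def
    by (intro linear_compose_sum ballI linearI) auto
  have neg: "B v v \<le> 0" if "\<phi> v = 0" for v
  proof -
    have "B v v = (\<Sum>i\<in>UNIV. \<Sum>j\<in>- {i}. v $ i * v $ j * h {i, j})"
      by (simp add: B_def dderiv_def sum_distrib_left insert_commute mult.assoc)
    also have "\<dots> = (\<Sum>i\<in>UNIV. \<Sum>j\<in>UNIV. if i \<in> S \<and> j \<in> S \<and> i \<noteq> j then v $ i * v $ j * (b i + b j - W i j) else 0)"
      by (intro sum.cong sum.mono_neutral_cong_left) (auto simp: hij)
    also have "\<dots> = (\<Sum>i\<in>S. \<Sum>j\<in>S. if i \<noteq> j then v $ i * v $ j * (b i + b j - W i j) else 0)"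
      by (intro sum.mono_neutral_cong_right) (auto intro!: sum.neutral sum.mono_neutral_cong_right)
    \<comment> \<open>The form has zero diagonal, whereas the formula would give
      \<open>2 * b i - W i i = g {i} - l {i}\<close> there. The correction has the right sign
      because \<open>l {i} \<le> g {i}\<close>.\<close>
    also have "\<dots> = (\<Sum>i\<in>S. (\<Sum>j\<in>S. v $ i * v $ j * (b i + b j - W i j)) - (v $ i)\<^sup>2 * (g {i} - l {i}))"
    proof (rule sum.cong[OF refl])
      fix i assume i: "i \<in> S"
      have "(\<Sum>j\<in>S. v $ i * v $ j * (b i + b j - W i j)) =
          (\<Sum>j\<in>S. (if i \<noteq> j then v $ i * v $ j * (b i + b j - W i j) else 0)
            + (if i = j then (v $ i)\<^sup>2 * (g {i} - l {i}) else 0))"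
        using i by (intro sum.cong) (auto simp: W_diag b_def power2_eq_square)
      then show "(\<Sum>j\<in>S. if i \<noteq> j then v $ i * v $ j * (b i + b j - W i j) else 0) =
          (\<Sum>j\<in>S. v $ i * v $ j * (b i + b j - W i j)) - (v $ i)\<^sup>2 * (g {i} - l {i})"
        using i by (simp add: sum.distrib)
    qed
    also have "\<dots> = (\<Sum>i\<in>S. \<Sum>j\<in>S. v $ i * v $ j * (b i + b j - W i j)) - (\<Sum>i\<in>S. (v $ i)\<^sup>2 * (g {i} - l {i}))"
      by (simp add: sum_subtractf)
    also have "(\<Sum>i\<in>S. \<Sum>j\<in>S. v $ i * v $ j * (b i + b j - W i j)) =
        2 * \<phi> v * (\<Sum>i\<in>S. b i * v $ i) - (\<Sum>i\<in>S. \<Sum>j\<in>S. v $ i * v $ j * W i j)"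
    proof -
      have "(\<Sum>i\<in>S. \<Sum>j\<in>S. v $ i * v $ j * b i) = \<phi> v * (\<Sum>i\<in>S. b i * v $ i)"
        unfolding \<phi>_def sum_product by (subst sum.swap) (simp add: mult_ac)
      moreover from this have "(\<Sum>i\<in>S. \<Sum>j\<in>S. v $ i * v $ j * b j) = \<phi> v * (\<Sum>i\<in>S. b i * v $ i)"
        by (subst sum.swap) (simp add: mult_ac)
      ultimately show ?thesis by (simp add: algebra_simps sum.distrib sum_subtractf)
    qed
    also have "(\<Sum>i\<in>S. \<Sum>j\<in>S. v $ i * v $ j * W i j) = (\<Sum>u\<in>U. w u * (\<Sum>i\<in>S. v $ i * a i u)\<^sup>2)"
    proof -
      have "(\<Sum>i\<in>S. \<Sum>j\<in>S. v $ i * v $ j * W i j)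
          = (\<Sum>i\<in>S. \<Sum>j\<in>S. \<Sum>u\<in>U. w u * ((v $ i * a i u) * (v $ j * a j u)))"
        by (simp add: W_def sum_distrib_left mult_ac)
      also have "\<dots> = (\<Sum>u\<in>U. \<Sum>i\<in>S. \<Sum>j\<in>S. w u * ((v $ i * a i u) * (v $ j * a j u)))"
        by (subst sum.swap[of _ S U], rule sum.cong[OF refl], rule sum.swap)
      also have "\<dots> = (\<Sum>u\<in>U. w u * (\<Sum>i\<in>S. v $ i * a i u)\<^sup>2)"
        unfolding power2_eq_square sum_product by (simp add: sum_distrib_left)
      finally show ?thesis .
    qed
    finally have "B v v = - (\<Sum>u\<in>U. w u * (\<Sum>i\<in>S. v $ i * a i u)\<^sup>2) - (\<Sum>i\<in>S. (v $ i)\<^sup>2 * (g {i} - l {i}))"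
      using that by simp
    moreover have "0 \<le> (\<Sum>u\<in>U. w u * (\<Sum>i\<in>S. v $ i * a i u)\<^sup>2)"
      using w by (intro sum_nonneg) auto
    moreover have "0 \<le> (\<Sum>i\<in>S. (v $ i)\<^sup>2 * (g {i} - l {i}))"
      using lg by (intro sum_nonneg mult_nonneg_nonneg) auto
    ultimately show ?thesis by linarith
  qed
  have "0 \<le> B y y" if "\<forall>i. 0 \<le> y $ i" for y
  proof -
    have "0 \<le> foldr dderiv [y, y] h {}"
      using h_nonneg that by (intro foldr_dderiv_nonneg) auto
    then show ?thesis by (simp add: B_def)
  qed
  then show ?thesis
    unfolding hyperbolic_form_def B_def[symmetric]
    by (intro allI impI bilinear_hyperbolic[OF B sym \<open>linear \<phi>\<close> neg]) auto
qed

section \<open>Log-concavity\<close>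

text \<open>Reindexing pairs \<open>(S, i)\<close> with \<open>i \<notin> S\<close> by
  \<open>T = insert i S\<close> produces the shape in which the product rule delivers the
  derivative.\<close>

lemma eval_gen_poly_dderiv:
  "eval_poly (gen_poly (dderiv v h)) x = (\<Sum>T\<in>UNIV. \<Sum>i\<in>T. v $ i * h T * (\<Prod>j\<in>T - {i}. x $ j))"
proof -
  have "eval_poly (gen_poly (dderiv v h)) x =
      (\<Sum>S\<in>UNIV. \<Sum>i\<in>- S. v $ i * h (insert i S) * (\<Prod>j\<in>S. x $ j))"
    by (simp add: eval_gen_poly dderiv_def sum_distrib_right)
  also have "\<dots> = (\<Sum>(S, i)\<in>(SIGMA S:UNIV. - S). v $ i * h (insert i S) * (\<Prod>j\<in>S. x $ j))"
    by (rule sum.Sigma) auto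
  also have "\<dots> = (\<Sum>(T, i)\<in>(SIGMA T:UNIV. T). v $ i * h T * (\<Prod>j\<in>T - {i}. x $ j))"
    by (rule sum.reindex_bij_witness[of _ "\<lambda>(T, i). (T - {i}, i)" "\<lambda>(S, i). (insert i S, i)"])
       (auto simp: insert_absorb)
  also have "\<dots> = (\<Sum>T\<in>UNIV. \<Sum>i\<in>T. v $ i * h T * (\<Prod>j\<in>T - {i}. x $ j))"
    by (rule sum.Sigma[symmetric]) auto
  finally show ?thesis .
qed

lemma eval_gen_poly_has_derivative:
  "((\<lambda>t. eval_poly (gen_poly h) (x + t *\<^sub>R v)) has_real_derivative
     eval_poly (gen_poly (dderiv v h)) (x + t *\<^sub>R v)) (at t)"
  unfolding eval_gen_poly_dderiv unfolding eval_gen_poly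
proof (intro DERIV_sum)
  fix S :: "'a set"
  have "((\<lambda>t. \<Prod>i\<in>S. (x + t *\<^sub>R v) $ i) has_real_derivative
      (\<Sum>i\<in>S. v $ i * (\<Prod>j\<in>S - {i}. (x + t *\<^sub>R v) $ j))) (at t)"
    by (intro has_field_derivative_prod) (auto intro!: derivative_eq_intros)
  from DERIV_cmult[OF this, of "h S"]
  show "((\<lambda>t. h S * (\<Prod>i\<in>S. (x + t *\<^sub>R v) $ i)) has_real_derivative
      (\<Sum>i\<in>S. v $ i * h S * (\<Prod>j\<in>S - {i}. (x + t *\<^sub>R v) $ j))) (at t)"
    by (simp add: sum_distrib_left mult_ac)
qed

lemma eval_gen_poly_euler:
  assumes "homogeneous_set_fun m h"
  shows "eval_poly (gen_poly (dderiv x h)) x = real m * eval_poly (gen_poly h) x"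
proof -
  have "(\<Sum>i\<in>T. x $ i * h T * (\<Prod>j\<in>T - {i}. x $ j)) = real m * (h T * (\<Prod>j\<in>T. x $ j))" for T
  proof -
    have "x $ i * h T * (\<Prod>j\<in>T - {i}. x $ j) = h T * (\<Prod>j\<in>T. x $ j)" if "i \<in> T" for i
      using that by (simp add: prod.remove[of T i])
    then have "(\<Sum>i\<in>T. x $ i * h T * (\<Prod>j\<in>T - {i}. x $ j)) = real (card T) * (h T * (\<Prod>j\<in>T. x $ j))"
      by (simp only: sum_constant cong: sum.cong)
    then show ?thesis using assms by (cases "h T = 0") (auto simp: homogeneous_set_fun_def)
  qed
  then show ?thesis by (simp only: eval_gen_poly_dderiv) (simp add: eval_gen_poly sum_distrib_left)
qed

text \<open>Iterated Euler formula: it turns values of a polynomial at \<open>x\<close> into mixed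
  derivatives with \<open>x\<close> repeated, where the Alexandrov-Fenchel inequality
  applies.\<close>

lemma foldr_dderiv_replicate:
  assumes "homogeneous_set_fun m h"
  shows "foldr dderiv (replicate m x) h {} = fact m * eval_poly (gen_poly h) x"
  using assms
proof (induction m arbitrary: h)
  case 0
  then have "eval_poly (gen_poly h) x = (\<Sum>S\<in>{{}}. h S * (\<Prod>i\<in>S. x $ i))"
    unfolding eval_gen_poly
    by (intro sum.mono_neutral_right) (auto simp: homogeneous_set_fun_def)
  then show ?case by simp
next
  case (Suc m)
  have "foldr dderiv (replicate (Suc m) x) h {} = foldr dderiv (replicate m x) (dderiv x h) {}"
    by (simp only: replicate_Suc foldr.simps o_apply foldr_dderiv_commute)
  also have "\<dots> = fact m * eval_poly (gen_poly (dderiv x h)) x"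
    by (rule Suc.IH[OF homogeneous_dderiv[OF Suc.prems]])
  finally show ?case by (simp add: eval_gen_poly_euler[OF Suc.prems] algebra_simps)
qed

text \<open>Along a segment the second derivative of ln p is (p'' p - p'^2) / p^2. As p may vanish
  on the boundary of the orthant, convexity of its positivity set is proved separately.\<close>

lemma log_concave_gen_poly:
  fixes h :: "'n::finite set \<Rightarrow> real"
  assumes h: "\<And>S. 0 \<le> h S"
    and ineq: "\<And>u v. u \<in> nonneg_orthant \<Longrightarrow>
      eval_poly (gen_poly (dderiv v (dderiv v h))) u * eval_poly (gen_poly h) u
        \<le> (eval_poly (gen_poly (dderiv v h)) u)\<^sup>2"
  shows "log_concave_poly (gen_poly h)"
proof -
  let ?E = "\<lambda>h x. eval_poly (gen_poly h) x"
  let ?P = "{x \<in> nonneg_orthant. 0 < ?E h x}"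
  have nonneg: "0 \<le> ?E h x" if "x \<in> nonneg_orthant" for x
    using that h unfolding eval_gen_poly nonneg_orthant_def
    by (intro sum_nonneg mult_nonneg_nonneg prod_nonneg) auto
  \<comment> \<open>On the orthant, positivity depends only on which coordinates are positive. A
    convex combination with nonzero weight on a point keeps the positive coordinates of that
    point.\<close>
  have ex: "0 < ?E h x \<longleftrightarrow> (\<exists>S. 0 < h S \<and> (\<forall>i\<in>S. 0 < x $ i))" if x: "x \<in> nonneg_orthant" for x
  proof
    assume "0 < ?E h x"
    then have "(\<Sum>S\<in>UNIV. h S * (\<Prod>i\<in>S. x $ i)) \<noteq> 0" by (simp add: eval_gen_poly)
    then obtain S where "h S * (\<Prod>i\<in>S. x $ i) \<noteq> 0"
      by (rule sum.not_neutral_contains_not_neutral)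
    then have "0 < h S \<and> (\<forall>i\<in>S. 0 < x $ i)"
      using h[of S] x by (auto simp: nonneg_orthant_def less_le)
    then show "\<exists>S. 0 < h S \<and> (\<forall>i\<in>S. 0 < x $ i)" ..
  next
    assume "\<exists>S. 0 < h S \<and> (\<forall>i\<in>S. 0 < x $ i)"
    then obtain S where "0 < h S" "\<forall>i\<in>S. 0 < x $ i" by blast
    then show "0 < ?E h x" unfolding eval_gen_poly
      using x h by (intro sum_pos2[where i = S]) (auto intro!: mult_pos_pos mult_nonneg_nonneg prod_pos prod_nonneg simp: nonneg_orthant_def)
  qed
  have convex: "convex ?P"
  proof (rule convexI)
    fix x y :: "real ^ 'n" and s t :: real
    assume xy: "x \<in> ?P" "y \<in> ?P" and st: "0 \<le> s" "0 \<le> t" "s + t = 1"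
    have o: "s *\<^sub>R x + t *\<^sub>R y \<in> nonneg_orthant" using xy st by (simp add: nonneg_orthant_def)
    have "s \<noteq> 0 \<or> t \<noteq> 0" using st by auto
    then have "0 < ?E h (s *\<^sub>R x + t *\<^sub>R y)"
    proof
      assume "s \<noteq> 0"
      obtain S where S: "0 < h S" "\<forall>i\<in>S. 0 < x $ i" using xy(1) ex[of x] by auto
      have "\<forall>i\<in>S. 0 < (s *\<^sub>R x + t *\<^sub>R y) $ i"
        using S \<open>s \<noteq> 0\<close> st xy by (auto simp: nonneg_orthant_def intro!: add_pos_nonneg)
      with S show ?thesis unfolding ex[OF o] by blast
    next
      assume "t \<noteq> 0"
      obtain S where S: "0 < h S" "\<forall>i\<in>S. 0 < y $ i" using xy(2) ex[of y] by auto
      have "\<forall>i\<in>S. 0 < (s *\<^sub>R x + t *\<^sub>R y) $ i"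
        using S \<open>t \<noteq> 0\<close> st xy by (auto simp: nonneg_orthant_def intro!: add_nonneg_pos)
      with S show ?thesis unfolding ex[OF o] by blast
    qed
    with o show "s *\<^sub>R x + t *\<^sub>R y \<in> ?P" by simp
  qed
  have "s * ln (?E h x) + t * ln (?E h y) \<le> ln (?E h (s *\<^sub>R x + t *\<^sub>R y))"
    if xy: "x \<in> ?P" "y \<in> ?P" and st: "0 \<le> s" "0 \<le> t" "s + t = 1" for x y s t
  proof -
    define v where "v = y - x"
    define p where "p k t = ?E k (x + t *\<^sub>R v)" for k t
    have seg: "x + t *\<^sub>R v = (1 - t) *\<^sub>R x + t *\<^sub>R y" for t
      by (simp add: v_def algebra_simps)
    have P: "x + t *\<^sub>R v \<in> ?P" if "t \<in> {0..1}" for t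
      unfolding seg using convexD[OF convex xy, of "1 - t" t] that by auto
    have pos: "0 < p h t" if "t \<in> {0..1}" for t using P[OF that] by (simp add: p_def)
    have deriv: "(p k has_real_derivative p (dderiv v k) t) (at t)" for k t
      unfolding p_def by (rule eval_gen_poly_has_derivative)
    have "concave_on {0..1} (\<lambda>t. ln (p h t))"
    proof (rule f''_le0_imp_concave)
      fix t :: real assume t: "t \<in> {0..1}"
      show "((\<lambda>t. ln (p h t)) has_real_derivative p (dderiv v h) t / p h t) (at t)"
        using deriv[of h t] pos[OF t] by (auto intro!: derivative_eq_intros simp: field_simps)
      show "((\<lambda>t. p (dderiv v h) t / p h t) has_real_derivative
          (p (dderiv v (dderiv v h)) t * p h t - p (dderiv v h) t * p (dderiv v h) t) / (p h t * p h t)) (at t)"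
        using deriv pos[OF t] by (intro DERIV_divide) auto
      have "p (dderiv v (dderiv v h)) t * p h t \<le> (p (dderiv v h) t)\<^sup>2"
        unfolding p_def using P[OF t] by (intro ineq) simp
      then show "(p (dderiv v (dderiv v h)) t * p h t - p (dderiv v h) t * p (dderiv v h) t) / (p h t * p h t) \<le> 0"
        using pos[OF t] by (simp add: power2_eq_square divide_nonpos_pos)
    qed simp
    from concave_onD[OF this, of t 0 1] st have "(1 - t) * ln (p h 0) + t * ln (p h 1) \<le> ln (p h t)"
      by simp
    moreover have "1 - t = s" using st by simp
    ultimately show ?thesis
      using seg[of t] by (simp add: p_def v_def)
  qed
  then have "concave_on ?P (\<lambda>x. ln (?E h x))"
    unfolding concave_on_iff by (intro conjI convex ballI allI impI)
  then show ?thesis unfolding log_concave_poly_def using nonneg by blast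
qed

section \<open>From mixed derivatives to complete log-concavity\<close>

lemma foldr_dir_deriv_gen_poly: "foldr dir_deriv as (gen_poly h) = gen_poly (foldr dderiv as h)"
  by (induction as) (auto simp: dir_deriv_gen_poly)

lemma homogeneous_foldr_dderiv:
  assumes "homogeneous_set_fun (length as + m) h"
  shows "homogeneous_set_fun m (foldr dderiv as h)"
  using assms
proof (induction as arbitrary: m)
  case (Cons a as)
  then show ?case by (auto intro!: homogeneous_dderiv)
qed simp

lemma foldr_dderiv_homogeneous_0:
  assumes "homogeneous_set_fun m h" "m < length as"
  shows "foldr dderiv as h = (\<lambda>_. 0)"
  using assms
proof (induction as arbitrary: m)
  case (Cons a as)
  show ?case
  proof (cases "m < length as")
    case True
    then show ?thesis using Cons by simp
  next
    case False
    then have "homogeneous_set_fun 0 (foldr dderiv as h)"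
      using Cons.prems by (intro homogeneous_foldr_dderiv) (auto simp: less_Suc_eq)
    then show ?thesis by (simp add: dderiv_homogeneous_0)
  qed
qed simp

text \<open>The point \<open>u\<close>, repeated \<open>d - 2 - length as\<close> times, fills the
  list \<open>as\<close> up to length \<open>d - 2\<close>. The inequality for the resulting form at
  \<open>v\<close> and \<open>u\<close> becomes, by Euler's formula, the one for the derivative
  \<open>k\<close> and its derivatives along \<open>v\<close>.\<close>

lemma completely_log_concave_gen_poly:
  fixes h :: "'n::finite set \<Rightarrow> real"
  assumes h: "\<And>S. 0 \<le> h S" and hom: "homogeneous_set_fun d h"
    and conn: "\<And>\<tau>. card \<tau> \<le> d - 2 \<Longrightarrow> connected_support (link h \<tau>)"
    and hyp: "\<And>\<tau>. card \<tau> = d - 2 \<Longrightarrow> hyperbolic_form (\<lambda>v w. dderiv v (dderiv w (link h \<tau>)) {})"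
  shows "completely_log_concave_poly (gen_poly h)"
  unfolding completely_log_concave_poly_def foldr_dir_deriv_gen_poly
proof (intro allI impI log_concave_gen_poly)
  fix as :: "(real ^ 'n) list" assume as: "set as \<subseteq> nonneg_orthant"
  define k where "k = foldr dderiv as h"
  show "0 \<le> foldr dderiv as h S" for S
    using as h by (intro foldr_dderiv_nonneg) (auto simp: nonneg_orthant_def)
  fix u v :: "real ^ 'n" assume u: "u \<in> nonneg_orthant"
  let ?E = "\<lambda>h. eval_poly (gen_poly h) u"
  have "?E (dderiv v (dderiv v k)) * ?E k \<le> (?E (dderiv v k))\<^sup>2"
  proof (cases "length as + 2 \<le> d")
    \<comment> \<open>Fewer than two degrees remain, so the second derivative vanishes.\<close>
    case False
    have "dderiv v (dderiv v k) = foldr dderiv (v # v # as) h" by (simp add: k_def)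
    also have "\<dots> = (\<lambda>_. 0)" using False by (intro foldr_dderiv_homogeneous_0[OF hom]) simp
    finally show ?thesis by (simp add: eval_gen_poly)
  next
    case True
    define m where "m = d - 2 - length as"
    have d: "d = length as + Suc (Suc m)" using True by (simp add: m_def)
    have hk: "homogeneous_set_fun (Suc (Suc m)) k"
      unfolding k_def by (rule homogeneous_foldr_dderiv) (use hom d in simp)
    have hk1: "homogeneous_set_fun (Suc m) (dderiv x k)" for x
      by (rule homogeneous_dderiv[OF hk])
    have mixed: "foldr dderiv (replicate m u @ as) (dderiv x (dderiv y h)) {} = fact m * ?E (dderiv x (dderiv y k))"
      for x y
      using foldr_dderiv_replicate[OF homogeneous_dderiv[OF hk1], of u x y]
      by (simp add: k_def foldr_dderiv_commute)
    have "hyperbolic_form (\<lambda>x y. foldr dderiv (replicate m u @ as) (dderiv x (dderiv y h)) {})"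
    proof (rule hyperbolic_form_mixed)
      fix a i assume "a \<in> set (replicate m u @ as)"
      then show "0 \<le> a $ i" using u as by (auto simp: nonneg_orthant_def split: if_splits)
    next
      have "d - 2 = length (replicate m u @ as)" using d by simp
      then show "connected_support (link h \<tau>)" if "card \<tau> \<le> length (replicate m u @ as)" for \<tau>
        using conn[of \<tau>] that by simp
      show "hyperbolic_form (\<lambda>v w. dderiv v (dderiv w (link h \<tau>)) {})"
        if "card \<tau> = length (replicate m u @ as)" for \<tau>
        using hyp[of \<tau>] that d by simp
      show "homogeneous_set_fun (length (replicate m u @ as) + 2) h"
        using hom d by (simp add: add.commute)
    qed (rule h)
    then have "(fact m * ?E (dderiv v (dderiv v k))) * (fact m * ?E (dderiv u (dderiv u k)))
        \<le> (fact m * ?E (dderiv v (dderiv u k)))\<^sup>2"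
      using u unfolding hyperbolic_form_def mixed by (simp add: nonneg_orthant_def)
    then have "(fact m)\<^sup>2 * (?E (dderiv v (dderiv v k)) * ?E (dderiv u (dderiv u k)))
        \<le> (fact m)\<^sup>2 * (?E (dderiv v (dderiv u k)))\<^sup>2"
      by (simp add: power2_eq_square mult_ac)
    then have "?E (dderiv v (dderiv v k)) * ?E (dderiv u (dderiv u k)) \<le> (?E (dderiv v (dderiv u k)))\<^sup>2"
      by (rule mult_left_le_imp_le) simp
    moreover have "?E (dderiv u (dderiv u k)) = real (Suc m) * (real (Suc (Suc m)) * ?E k)"
      by (simp only: eval_gen_poly_euler[OF hk1] eval_gen_poly_euler[OF hk])
    moreover have "?E (dderiv v (dderiv u k)) = real (Suc m) * ?E (dderiv v k)"
      by (simp only: dderiv_commute[of v u] eval_gen_poly_euler[OF hk1])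
    ultimately have "real (Suc m) * (real (Suc (Suc m)) * (?E (dderiv v (dderiv v k)) * ?E k))
        \<le> real (Suc m) * (real (Suc m) * (?E (dderiv v k))\<^sup>2)"
      by (simp only: power2_eq_square mult_ac)
    then have "real (Suc (Suc m)) * (?E (dderiv v (dderiv v k)) * ?E k) \<le> real (Suc m) * (?E (dderiv v k))\<^sup>2"
      by (rule mult_left_le_imp_le) simp
    \<comment> \<open>Euler's formula yields the sharper factor (m + 1) / (m + 2), which is weakened
      to 1.\<close>
    also have "\<dots> \<le> real (Suc (Suc m)) * (?E (dderiv v k))\<^sup>2" by (intro mult_right_mono) auto
    finally show ?thesis by (rule mult_left_le_imp_le) simp
  qed
  then show "?E (dderiv v (dderiv v (foldr dderiv as h))) * ?E (foldr dderiv as h)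
      \<le> (?E (dderiv v (foldr dderiv as h)))\<^sup>2"
    by (simp add: k_def)
qed

section \<open>Layers of 2-coverage functions\<close>

theorem mainTheorem1:
  fixes f :: "'n::finite set \<Rightarrow> real" and d :: nat
  assumes "\<And>S. 0 \<le> f S"
    and "f {} = 0"
    and "2 \<le> d" and "d \<le> set_fun_degree f"
    and "two_coverage f d"
  shows "completely_log_concave_poly (gen_poly (layer f d))"
proof (rule completely_log_concave_gen_poly)
  show "0 \<le> layer f d S" for S using assms(1) by (simp add: layer_def)
  show "homogeneous_set_fun d (layer f d)" by (simp add: homogeneous_set_fun_def layer_def)
  fix \<tau> :: "'n set"
  show "connected_support (link (layer f d) \<tau>)" if "card \<tau> \<le> d - 2"
  proof (rule connected_support_of_indecomposable)
    show "indecomposable_set_fun (link (layer f d) \<tau>)"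
      using assms(5) that unfolding two_coverage_def by blast
    \<comment> \<open>This value is \<open>layer f d \<tau>\<close>, and \<tau> has fewer than
      \<open>d\<close> elements.\<close>
    show "link (layer f d) \<tau> {} = 0" using that assms(3) by (simp add: link_def layer_def)
  qed
  show "hyperbolic_form (\<lambda>v w. dderiv v (dderiv w (link (layer f d) \<tau>)) {})" if \<tau>: "card \<tau> = d - 2"
  proof -
    obtain S g l where S: "S \<subseteq> - \<tau>" "coverage_on S g" "linear_set_fun_on S l" "\<forall>i\<in>S. l {i} \<le> g {i}"
      and f: "\<forall>T. T \<subseteq> - \<tau> \<and> card T = 2 \<longrightarrow> link f \<tau> T = (if T \<subseteq> S then g T - l T / 2 else 0)"
      using assms(5) \<tau> unfolding two_coverage_def by blast
    show ?thesis
    proof (rule hyperbolic_form_coverage[OF S(2,3)])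
      show "0 \<le> link (layer f d) \<tau> T" for T using assms(1) by (simp add: link_def layer_def)
      fix T :: "'n set" assume T: "card T = 2"
      show "link (layer f d) \<tau> T = (if T \<subseteq> S then g T - l T / 2 else 0)"
      proof (cases "T \<inter> \<tau> = {}")
        case True
        then have "card (T \<union> \<tau>) = d" using T \<tau> assms(3) by (simp add: card_Un_disjoint)
        then have "link (layer f d) \<tau> T = link f \<tau> T" by (simp add: link_def layer_def)
        then show ?thesis using f T True by (simp add: disjoint_eq_subset_Compl)
      next
        \<comment> \<open>The link vanishes on sets meeting \<tau>, and such sets are not contained
          in \<open>S\<close>.\<close>
        case False
        then show ?thesis using S(1) by (auto simp: link_def)
      qed
    qed (use S in auto)
  qed
qed

end
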